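(* Let $A \in \mathbb{R}^{n\times m}$ with $n \ge m$ and let $Z \in \mathbb{R}^{n\times p}$ be a full column rank matrix with $p \le \mathrm{rank}(A)$. For a given $k \in \{1,\dots,p\}$, set $\Omega_k = U_k^{T} Z \in \mathbb{R}^{k\times p}$ and $\underline{\Omega}_k = \underline{U}_k^{T} Z \in \mathbb{R}^{(n-k)\times p}$, and assume that $\Omega_k$ has full row rank (i.e. $\mathrm{rank}(\Omega_k)=k$). Let $T_k = \underline{\Omega}_k \Omega_k^{\dagger} \in \mathbb{R}^{(n-k)\times k}$ and $S_k = (I_{n-k} + T_k T_k^{T})^{-1/2} T_k \in \mathbb{R}^{(n-k)\times k}$. Then, both for the spectral norm ($\|\cdot\|=\|\cdot\|_2$) and for the Frobenius norm ($\|\cdot\|=\|\cdot\|_F$), $$\|[I_n-\pi(Z)]A\|^2 - \|[I_n-\pi(Z)]\underline{A}_k\|^2 \;\le\; \|[I_n-\pi(Z)]A_k\|^2 \;\le\; \min\left\{ \|S_k\|^2\,\|\Sigma_k\|_2^2,\; \|T_k\Sigma_k\|^2 \right\}.$$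
   Context: $A = U\Sigma V^{T}$ is a singular value decomposition, with $U\in\mathbb{R}^{n\times n}$, $V\in\mathbb{R}^{m\times m}$ orthogonal and $\Sigma\in\mathbb{R}^{n\times m}$ diagonal with singular values $\sigma_1\ge\dots\ge\sigma_m\ge 0$. Partition $U=[U_k\ \ \underline{U}_k]$, $V=[V_k\ \ \underline{V}_k]$, $\Sigma=\mathrm{diag}(\Sigma_k,\underline{\Sigma}_k)$ with $U_k\in\mathbb{R}^{n\times k}$, $\underline{U}_k\in\mathbb{R}^{n\times(n-k)}$, $V_k\in\mathbb{R}^{m\times k}$, $\underline{V}_k\in\mathbb{R}^{m\times(m-k)}$, $\Sigma_k=\mathrm{diag}(\sigma_1,\dots,\sigma_k)\in\mathbb{R}^{k\times k}$, $\underline{\Sigma}_k\in\mathbb{R}^{(n-k)\times(m-k)}$. Set $A_k=U_k\Sigma_kV_k^{T}$ and $\underline{A}_k=\underline{U}_k\underline{\Sigma}_k\underline{V}_k^{T}$, so $A=A_k+\underline{A}_k$. $\pi(Z)=ZZ^{\dagger}$ is the orthogonal projection onto the range (column space) of $Z$, $M^{\dagger}$ denotes the Moore-Penrose inverse, and $I_n$ is the identity of order $n$. *)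

theory Defs
  imports "Jordan_Normal_Form.DL_Rank" "Jordan_Normal_Form.Gauss_Jordan_Elimination"
begin

abbreviation mat_rank :: "real mat \<Rightarrow> nat" where
  "mat_rank A \<equiv> vec_space.rank (dim_row A) A"

text \<open>The counterpart of \<^const>\<open>append_rows\<close>: the block row \<open>[A B]\<close>.\<close>

definition append_cols :: "real mat \<Rightarrow> real mat \<Rightarrow> real mat" where
  "append_cols A B = four_block_mat A B (0\<^sub>m 0 (dim_col A)) (0\<^sub>m 0 (dim_col B))"

definition vec_norm2 :: "real vec \<Rightarrow> real" where
  "vec_norm2 x = sqrt (x \<bullet> x)"

text \<open>The supremum ranges over the closed unit ball rather than the unit sphere, so that
  the norm of a matrix without columns is 0 and not the supremum of the empty set.\<close>

definition spectral_norm :: "real mat \<Rightarrow> real" where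
  "spectral_norm A = Sup {vec_norm2 (A *\<^sub>v x) | x. x \<in> carrier_vec (dim_col A) \<and> vec_norm2 x \<le> 1}"

definition frobenius_norm :: "real mat \<Rightarrow> real" where
  "frobenius_norm A = sqrt (\<Sum>i<dim_row A. \<Sum>j<dim_col A. (A $$ (i, j))\<^sup>2)"

text \<open>The library's \<^const>\<open>orthogonal_mat\<close> only asks for pairwise orthogonal nonzero columns.\<close>

definition orthonormal_mat :: "nat \<Rightarrow> real mat \<Rightarrow> bool" where
  "orthonormal_mat n Q \<longleftrightarrow>
     Q \<in> carrier_mat n n \<and> transpose_mat Q * Q = 1\<^sub>m n \<and> Q * transpose_mat Q = 1\<^sub>m n"

definition is_svd :: "nat \<Rightarrow> nat \<Rightarrow> real mat \<Rightarrow> real mat \<Rightarrow> real mat \<Rightarrow> real mat \<Rightarrow> bool" where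
  "is_svd n m A U S V \<longleftrightarrow>
     A \<in> carrier_mat n m \<and> orthonormal_mat n U \<and> orthonormal_mat m V \<and>
     S \<in> carrier_mat n m \<and> diagonal_mat S \<and>
     (\<forall>i < min n m. 0 \<le> S $$ (i, i)) \<and>
     (\<forall>j < min n m. \<forall>i \<le> j. S $$ (j, j) \<le> S $$ (i, i)) \<and>
     A = U * S * transpose_mat V"

text \<open>The Penrose equations, which have exactly one solution.\<close>

definition is_mp_inverse :: "real mat \<Rightarrow> real mat \<Rightarrow> bool" where
  "is_mp_inverse M X \<longleftrightarrow>
     X \<in> carrier_mat (dim_col M) (dim_row M) \<and>
     M * X * M = M \<and> X * M * X = X \<and>
     transpose_mat (M * X) = M * X \<and> transpose_mat (X * M) = X * M"

definition mp_inverse :: "real mat \<Rightarrow> real mat" where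
  "mp_inverse M = (THE X. is_mp_inverse M X)"

definition range_proj :: "real mat \<Rightarrow> real mat" where
  "range_proj Z = Z * mp_inverse Z"

definition psd_mat :: "real mat \<Rightarrow> bool" where
  "psd_mat M \<longleftrightarrow> square_mat M \<and> transpose_mat M = M \<and>
     (\<forall>x \<in> carrier_vec (dim_row M). 0 \<le> x \<bullet> (M *\<^sub>v x))"

text \<open>The symmetric positive semidefinite square root; meaningful for symmetric positive
  semidefinite arguments.\<close>

definition mat_sqrt :: "real mat \<Rightarrow> real mat" where
  "mat_sqrt M = (THE X. X \<in> carrier_mat (dim_row M) (dim_row M) \<and> psd_mat X \<and> X * X = M)"

text \<open>The power \<open>M\<^sup>-\<^sup>1\<^sup>/\<^sup>2\<close>; meaningful for symmetric positive definite arguments.\<close>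

definition mat_inv_sqrt :: "real mat \<Rightarrow> real mat" where
  "mat_inv_sqrt M = the (mat_inverse (mat_sqrt M))"

end

theory Submission
  imports Defs "HOL-Analysis.L2_Norm" "Jordan_Normal_Form.Spectral_Radius"
begin

text \<open>Write \<open>C = I - \<pi>(Z)\<close> and let \<open>U\<^sub>r\<close>, \<open>A\<^sub>r\<close> be the trailing blocks. Since
  \<open>Z \<Omega>\<^sub>k\<^sup>+ = U\<^sub>k + U\<^sub>r T\<^sub>k\<close> is annihilated by \<open>C\<close>, we have \<open>C U\<^sub>k = K T\<^sub>k\<close> for the contraction
  \<open>K = - C U\<^sub>r\<close>; hence \<open>C A\<^sub>k = K (T\<^sub>k \<Sigma>\<^sub>k) V\<^sub>k\<^sup>T\<close>, which gives the bound by \<open>T\<^sub>k \<Sigma>\<^sub>k\<close>.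
  If \<open>X\<close> is the square root of \<open>I + T\<^sub>k T\<^sub>k\<^sup>T\<close>, then also \<open>C U\<^sub>k = (K X) S\<^sub>k\<close>, and
  \<open>(K X) (K X)\<^sup>T = K K\<^sup>T + (K T\<^sub>k) (K T\<^sub>k)\<^sup>T = C (U\<^sub>r U\<^sub>r\<^sup>T + U\<^sub>k U\<^sub>k\<^sup>T) C = C\<close>, so \<open>K X\<close> is a
  contraction as well, which gives the bound by \<open>S\<^sub>k\<close>. The lower bound holds because
  \<open>A\<^sub>k A\<^sub>r\<^sup>T = 0\<close>, so that the Gram matrices of \<open>C A\<^sub>k\<close> and \<open>C A\<^sub>r\<close> add up to that of \<open>C A\<close>.\<close>

section \<open>Spectral and Frobenius norms\<close>

lemma scalar_prod_self_nonneg: "0 \<le> x \<bullet> (x :: real vec)"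
  unfolding scalar_prod_def by (simp add: sum_nonneg)

lemma scalar_prod_self_eq_0:
  assumes "(x :: real vec) \<in> carrier_vec n" and "x \<bullet> x = 0"
  shows "x = 0\<^sub>v n"
proof (rule eq_vecI)
  fix i assume i: "i < dim_vec (0\<^sub>v n :: real vec)"
  have "\<forall>i\<in>{0..<dim_vec x}. x $ i * x $ i = 0"
    using assms(2) unfolding scalar_prod_def by (subst (asm) sum_nonneg_eq_0_iff) auto
  then show "x $ i = 0\<^sub>v n $ i" using i assms(1) by auto
qed (use assms in auto)

lemma vec_norm2_nonneg [simp]: "0 \<le> vec_norm2 x"
  unfolding vec_norm2_def by (simp add: scalar_prod_self_nonneg)

lemma vec_norm2_sq: "(vec_norm2 x)\<^sup>2 = x \<bullet> x"
  unfolding vec_norm2_def by (simp add: scalar_prod_self_nonneg)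

lemma vec_norm2_L2_set: "vec_norm2 x = L2_set (\<lambda>i. x $ i) {0..<dim_vec x}"
  unfolding vec_norm2_def L2_set_def scalar_prod_def by (simp add: power2_eq_square)

text \<open>Cauchy-Schwarz, transported from the inequality for \<open>L2_set\<close>.\<close>

lemma abs_scalar_prod_le_norm:
  assumes "x \<in> carrier_vec n" "y \<in> carrier_vec n"
  shows "\<bar>x \<bullet> y\<bar> \<le> vec_norm2 x * vec_norm2 y"
proof -
  have "\<bar>x \<bullet> y\<bar> \<le> (\<Sum>i\<in>{0..<n}. \<bar>x $ i\<bar> * \<bar>y $ i\<bar>)"
    unfolding scalar_prod_def using assms sum_abs[of "\<lambda>i. x $ i * y $ i" "{0..<n}"]
    by (simp add: abs_mult)
  also have "\<dots> \<le> vec_norm2 x * vec_norm2 y"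
    using L2_set_mult_ineq[of "\<lambda>i. x $ i" "\<lambda>i. y $ i" "{0..<n}"] assms
    by (simp add: vec_norm2_L2_set)
  finally show ?thesis .
qed

lemma scalar_prod_le_norm:
  assumes "x \<in> carrier_vec n" "y \<in> carrier_vec n"
  shows "x \<bullet> y \<le> vec_norm2 x * vec_norm2 y"
  using abs_scalar_prod_le_norm[OF assms] by simp

lemma vec_norm2_smult: "vec_norm2 (c \<cdot>\<^sub>v x) = \<bar>c\<bar> * vec_norm2 x"
proof -
  have "(c \<cdot>\<^sub>v x) \<bullet> (c \<cdot>\<^sub>v x) = c\<^sup>2 * (x \<bullet> x)"
    unfolding scalar_prod_def by (simp add: sum_distrib_left power2_eq_square algebra_simps)
  then show ?thesis unfolding vec_norm2_def by (simp add: real_sqrt_mult)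
qed

lemma vec_norm2_zero [simp]: "vec_norm2 (0\<^sub>v n) = 0"
  unfolding vec_norm2_def by (simp add: scalar_prod_def)

lemma frobenius_norm_nonneg [simp]: "0 \<le> frobenius_norm A"
  unfolding frobenius_norm_def by (auto intro!: sum_nonneg)

lemma frobenius_norm_sq: "(frobenius_norm A)\<^sup>2 = (\<Sum>i<dim_row A. \<Sum>j<dim_col A. (A $$ (i, j))\<^sup>2)"
  unfolding frobenius_norm_def by (auto intro!: sum_nonneg)

text \<open>Column \<open>j\<close> is the image of the \<open>j\<close>-th unit vector. In this
  form, estimates for the images of single vectors sum up to estimates for the Frobenius
  norm.\<close>

lemma frobenius_norm_sq_cols:
  "(frobenius_norm A)\<^sup>2 = (\<Sum>j<dim_col A. (vec_norm2 (A *\<^sub>v unit_vec (dim_col A) j))\<^sup>2)"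
proof -
  have "(vec_norm2 (A *\<^sub>v unit_vec (dim_col A) j))\<^sup>2 = (\<Sum>i<dim_row A. (A $$ (i, j))\<^sup>2)"
    if "j < dim_col A" for j
    unfolding vec_norm2_sq scalar_prod_def using that
    by (simp add: power2_eq_square atLeast0LessThan)
  then show ?thesis
    unfolding frobenius_norm_sq by (subst sum.swap) simp
qed

lemma frobenius_norm_transpose: "frobenius_norm (transpose_mat A) = frobenius_norm A"
  unfolding frobenius_norm_def by (subst sum.swap) simp

text \<open>Cauchy-Schwarz applied to each row. Its main use is to bound the set in the definition
  of \<open>spectral_norm\<close>, so that its \<open>Sup\<close> is a genuine supremum.\<close>

lemma vec_norm2_mult_le_frobenius:
  assumes "x \<in> carrier_vec (dim_col A)"
  shows "vec_norm2 (A *\<^sub>v x) \<le> frobenius_norm A * vec_norm2 x"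
proof (rule power2_le_imp_le)
  have row: "(row A i \<bullet> x)\<^sup>2 \<le> (vec_norm2 (row A i))\<^sup>2 * (vec_norm2 x)\<^sup>2" for i
    using abs_scalar_prod_le_norm[of "row A i" "dim_col A" x] assms
    by (simp add: abs_le_square_iff[symmetric] abs_mult flip: power_mult_distrib)
  have "(vec_norm2 (A *\<^sub>v x))\<^sup>2 = (\<Sum>i<dim_row A. (row A i \<bullet> x)\<^sup>2)"
    unfolding vec_norm2_sq scalar_prod_def[of _ "A *\<^sub>v x"]
    by (simp add: power2_eq_square atLeast0LessThan)
  also have "\<dots> \<le> (\<Sum>i<dim_row A. (vec_norm2 (row A i))\<^sup>2 * (vec_norm2 x)\<^sup>2)"
    by (intro sum_mono row)
  also have "\<dots> = (frobenius_norm A * vec_norm2 x)\<^sup>2"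
    by (simp add: sum_distrib_right[symmetric] frobenius_norm_sq power_mult_distrib vec_norm2_sq[of "row A _"]
        scalar_prod_def[of "row A _"] power2_eq_square[of "A $$ _"] atLeast0LessThan)
  finally show "(vec_norm2 (A *\<^sub>v x))\<^sup>2 \<le> (frobenius_norm A * vec_norm2 x)\<^sup>2" .
qed simp

lemma spectral_norm_bdd:
  "bdd_above {vec_norm2 (A *\<^sub>v x) | x. x \<in> carrier_vec (dim_col A) \<and> vec_norm2 x \<le> 1}"
proof (rule bdd_aboveI)
  fix r assume "r \<in> {vec_norm2 (A *\<^sub>v x) | x. x \<in> carrier_vec (dim_col A) \<and> vec_norm2 x \<le> 1}"
  then obtain x where "r = vec_norm2 (A *\<^sub>v x)" "x \<in> carrier_vec (dim_col A)" "vec_norm2 x \<le> 1"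
    by auto
  then show "r \<le> frobenius_norm A"
    using vec_norm2_mult_le_frobenius[of x A] mult_left_mono[of "vec_norm2 x" 1 "frobenius_norm A"]
    by simp
qed

lemma spectral_norm_nonneg [simp]: "0 \<le> spectral_norm A"
proof -
  have "vec_norm2 (A *\<^sub>v 0\<^sub>v (dim_col A)) \<le> spectral_norm A"
    unfolding spectral_norm_def by (rule cSup_upper[OF _ spectral_norm_bdd]) force
  then show ?thesis using vec_norm2_nonneg order_trans by blast
qed

lemma spectral_norm_mult_vec:
  assumes "x \<in> carrier_vec (dim_col A)"
  shows "vec_norm2 (A *\<^sub>v x) \<le> spectral_norm A * vec_norm2 x"
proof (cases "vec_norm2 x = 0")
  case True
  \<comment> \<open>A vector of norm 0 cannot be normalized; here the Frobenius bound already forces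
    the left side to be 0.\<close>
  then show ?thesis
    using vec_norm2_mult_le_frobenius[OF assms] by simp
next
  case False
  let ?c = "inverse (vec_norm2 x)"
  have "vec_norm2 (A *\<^sub>v (?c \<cdot>\<^sub>v x)) \<le> spectral_norm A"
    unfolding spectral_norm_def
    by (rule cSup_upper[OF _ spectral_norm_bdd])
      (use assms False in \<open>auto simp: vec_norm2_smult intro!: exI[of _ "?c \<cdot>\<^sub>v x"]\<close>)
  moreover have "A *\<^sub>v (?c \<cdot>\<^sub>v x) = ?c \<cdot>\<^sub>v (A *\<^sub>v x)"
    using mult_mat_vec[of A "dim_row A" "dim_col A" x] assms by auto
  ultimately have "?c * vec_norm2 (A *\<^sub>v x) \<le> spectral_norm A"
    by (simp add: vec_norm2_smult)
  moreover have "0 < vec_norm2 x" using False vec_norm2_nonneg[of x] by linarith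
  ultimately show ?thesis by (simp add: field_simps)
qed

text \<open>The premise \<open>0 \<le> c\<close> matters for a matrix without columns, where the
  first premise holds for every \<open>c\<close>.\<close>

lemma spectral_norm_le:
  assumes "\<And>x. x \<in> carrier_vec (dim_col A) \<Longrightarrow> vec_norm2 (A *\<^sub>v x) \<le> c * vec_norm2 x"
    and "0 \<le> c"
  shows "spectral_norm A \<le> c"
  unfolding spectral_norm_def
proof (rule cSup_least)
  show "{vec_norm2 (A *\<^sub>v x) | x. x \<in> carrier_vec (dim_col A) \<and> vec_norm2 x \<le> 1} \<noteq> {}"
    by (auto intro!: exI[of _ "0\<^sub>v (dim_col A)"])
next
  fix r assume "r \<in> {vec_norm2 (A *\<^sub>v x) | x. x \<in> carrier_vec (dim_col A) \<and> vec_norm2 x \<le> 1}"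
  then obtain x where "r = vec_norm2 (A *\<^sub>v x)" "x \<in> carrier_vec (dim_col A)" "vec_norm2 x \<le> 1"
    by auto
  then show "r \<le> c"
    using assms(1)[of x] mult_left_mono[of "vec_norm2 x" 1 c] assms(2) by simp
qed

lemma scalar_prod_transpose:
  fixes A :: "real mat"
  assumes "A \<in> carrier_mat r c" "x \<in> carrier_vec c" "y \<in> carrier_vec r"
  shows "(A *\<^sub>v x) \<bullet> y = x \<bullet> (transpose_mat A *\<^sub>v y)"
  using transpose_vec_mult_scalar[OF assms] assms
    comm_scalar_prod[of "A *\<^sub>v x" r y] comm_scalar_prod[of x c "transpose_mat A *\<^sub>v y"]
  by simp

lemma vec_norm2_sq_mult_mat_vec:
  assumes "A \<in> carrier_mat r c" "x \<in> carrier_vec c"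
  shows "(vec_norm2 (A *\<^sub>v x))\<^sup>2 = x \<bullet> (transpose_mat A * A *\<^sub>v x)"
proof -
  have "transpose_mat A * A *\<^sub>v x = transpose_mat A *\<^sub>v (A *\<^sub>v x)"
    using assms by (intro assoc_mult_mat_vec) auto
  then show ?thesis
    using scalar_prod_transpose[of A r c x "A *\<^sub>v x"] assms by (simp add: vec_norm2_sq)
qed

text \<open>For \<open>y\<close> the image of \<open>x\<close> under the transpose,
  \<open>y \<bullet> y = x \<bullet> (A *\<^sub>v y)\<close> is at most the product of the norms of
  \<open>x\<close>, \<open>A\<close> and \<open>y\<close>; one factor \<open>vec_norm2 y\<close>
  cancels.\<close>

lemma spectral_norm_transpose_le: "spectral_norm (transpose_mat A) \<le> spectral_norm A"
proof (rule spectral_norm_le)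
  fix x :: "real vec" assume "x \<in> carrier_vec (dim_col (transpose_mat A))"
  then have x: "x \<in> carrier_vec (dim_row A)" by simp
  let ?y = "transpose_mat A *\<^sub>v x"
  have y: "?y \<in> carrier_vec (dim_col A)" by (auto simp: carrier_dim_vec)
  have "(vec_norm2 ?y)\<^sup>2 = x \<bullet> (A *\<^sub>v ?y)"
    using transpose_vec_mult_scalar[OF carrier_matI[OF refl refl] y x] by (simp add: vec_norm2_sq)
  also have "\<dots> \<le> vec_norm2 x * vec_norm2 (A *\<^sub>v ?y)"
    by (rule scalar_prod_le_norm[OF x]) (auto simp: carrier_dim_vec)
  also have "\<dots> \<le> vec_norm2 x * (spectral_norm A * vec_norm2 ?y)"
    by (intro mult_left_mono spectral_norm_mult_vec y) auto
  finally have "vec_norm2 ?y * vec_norm2 ?y \<le> (spectral_norm A * vec_norm2 x) * vec_norm2 ?y"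
    by (simp add: power2_eq_square algebra_simps)
  then show "vec_norm2 ?y \<le> spectral_norm A * vec_norm2 x"
    using vec_norm2_nonneg[of ?y] by (cases "vec_norm2 ?y = 0") (auto simp: mult_le_cancel_right)
qed simp

lemma spectral_norm_transpose: "spectral_norm (transpose_mat A) = spectral_norm A"
  using spectral_norm_transpose_le[of A] spectral_norm_transpose_le[of "transpose_mat A"] by simp

lemma norm_transpose:
  assumes "N \<in> {spectral_norm, frobenius_norm}"
  shows "N (transpose_mat A) = N A"
  using assms by (auto simp: spectral_norm_transpose frobenius_norm_transpose)

lemma norm_nonneg:
  assumes "N \<in> {spectral_norm, frobenius_norm}"
  shows "0 \<le> N A"
  using assms by auto

text \<open>The pointwise premise is evaluated at unit vectors, that is, column by column. This
  covers the Frobenius case of \<open>norm_mult_left_le\<close>.\<close>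

lemma frobenius_norm_le:
  assumes "dim_col A = dim_col B" and "0 \<le> c"
    and "\<And>x. x \<in> carrier_vec (dim_col B) \<Longrightarrow> vec_norm2 (A *\<^sub>v x) \<le> c * vec_norm2 (B *\<^sub>v x)"
  shows "frobenius_norm A \<le> c * frobenius_norm B"
proof (rule power2_le_imp_le)
  have "(vec_norm2 (A *\<^sub>v unit_vec (dim_col B) j))\<^sup>2
      \<le> c\<^sup>2 * (vec_norm2 (B *\<^sub>v unit_vec (dim_col B) j))\<^sup>2" for j
    unfolding power_mult_distrib[symmetric]
    by (intro power_mono assms) auto
  then show "(frobenius_norm A)\<^sup>2 \<le> (c * frobenius_norm B)\<^sup>2"
    unfolding power_mult_distrib frobenius_norm_sq_cols assms(1) sum_distrib_left
    by (intro sum_mono) auto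
qed (use assms in auto)

lemma norm_mult_left_le:
  assumes "N \<in> {spectral_norm, frobenius_norm}" and "dim_col A = dim_row B"
  shows "N (A * B) \<le> spectral_norm A * N B"
proof -
  have *: "vec_norm2 (A * B *\<^sub>v x) \<le> spectral_norm A * vec_norm2 (B *\<^sub>v x)"
    if "x \<in> carrier_vec (dim_col B)" for x
  proof -
    have "A * B *\<^sub>v x = A *\<^sub>v (B *\<^sub>v x)"
      using that assms(2) by (intro assoc_mult_mat_vec) auto
    then show ?thesis using spectral_norm_mult_vec[of "B *\<^sub>v x" A] assms(2)
      by (simp add: carrier_dim_vec)
  qed
  have "spectral_norm (A * B) \<le> spectral_norm A * spectral_norm B"
  proof (rule spectral_norm_le)
    fix x :: "real vec" assume "x \<in> carrier_vec (dim_col (A * B))"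
    then have x: "x \<in> carrier_vec (dim_col B)" by simp
    show "vec_norm2 (A * B *\<^sub>v x) \<le> spectral_norm A * spectral_norm B * vec_norm2 x"
      using *[OF x] mult_left_mono[OF spectral_norm_mult_vec[OF x] spectral_norm_nonneg[of A]]
      by (simp add: mult.assoc)
  qed simp
  moreover have "frobenius_norm (A * B) \<le> spectral_norm A * frobenius_norm B"
    by (rule frobenius_norm_le) (use * in auto)
  ultimately show ?thesis using assms(1) by auto
qed

text \<open>Both norms are invariant under transposition, which exchanges the two factors.\<close>

lemma norm_mult_right_le:
  assumes "N \<in> {spectral_norm, frobenius_norm}" and "dim_col A = dim_row B"
  shows "N (A * B) \<le> N A * spectral_norm B"
proof -
  have "transpose_mat (A * B) = transpose_mat B * transpose_mat A"
    using assms(2) by (intro transpose_mult) auto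
  then have "N (A * B) = N (transpose_mat B * transpose_mat A)"
    using norm_transpose[OF assms(1)] by metis
  also have "\<dots> \<le> spectral_norm (transpose_mat B) * N (transpose_mat A)"
    by (rule norm_mult_left_le) (use assms in auto)
  finally show ?thesis
    using norm_transpose[OF assms(1)] by (simp add: spectral_norm_transpose mult.commute)
qed

text \<open>Cauchy-Schwarz for \<open>x \<bullet> (transpose_mat A * A *\<^sub>v x)\<close>. This
  half of the C*-identity is how contractions are recognized below: the Gram matrix is computed and
  bounded.\<close>

lemma spectral_norm_sq_le: "(spectral_norm A)\<^sup>2 \<le> spectral_norm (transpose_mat A * A)"
proof -
  let ?s = "sqrt (spectral_norm (transpose_mat A * A))"
  have "spectral_norm A \<le> ?s"
  proof (rule spectral_norm_le)
    fix x :: "real vec" assume x: "x \<in> carrier_vec (dim_col A)"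
    have "(vec_norm2 (A *\<^sub>v x))\<^sup>2 = x \<bullet> (transpose_mat A * A *\<^sub>v x)"
      by (rule vec_norm2_sq_mult_mat_vec[OF carrier_matI[OF refl refl] x])
    also have "\<dots> \<le> vec_norm2 x * vec_norm2 (transpose_mat A * A *\<^sub>v x)"
      by (rule scalar_prod_le_norm[OF x]) (simp add: carrier_dim_vec)
    also have "\<dots> \<le> vec_norm2 x * (spectral_norm (transpose_mat A * A) * vec_norm2 x)"
      using x by (intro mult_left_mono spectral_norm_mult_vec) auto
    also have "\<dots> = (?s * vec_norm2 x)\<^sup>2"
      by (simp add: power_mult_distrib power2_eq_square)
    finally show "vec_norm2 (A *\<^sub>v x) \<le> ?s * vec_norm2 x"
      by (rule power2_le_imp_le) simp
  qed simp
  then have "(spectral_norm A)\<^sup>2 \<le> ?s\<^sup>2" by (intro power_mono) auto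
  then show ?thesis by simp
qed

lemma spectral_norm_orthonormal_cols:
  assumes "transpose_mat Q * Q = 1\<^sub>m c"
  shows "spectral_norm Q \<le> 1"
proof -
  have "spectral_norm (1\<^sub>m c) \<le> 1" by (rule spectral_norm_le) auto
  then have "(spectral_norm Q)\<^sup>2 \<le> 1" using spectral_norm_sq_le[of Q] assms by simp
  then show ?thesis using power2_le_imp_le[of "spectral_norm Q" 1] by simp
qed

text \<open>Here \<open>P\<close> is its own Gram matrix, so the square of its norm is at most the
  norm; dividing requires the norm to be nonzero.\<close>

lemma spectral_norm_symmetric_idempotent:
  assumes "transpose_mat P = P" and "P * P = P"
  shows "spectral_norm P \<le> 1"
proof (cases "spectral_norm P = 0")
  case False
  then have "0 < spectral_norm P" using spectral_norm_nonneg[of P] by linarith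
  then show ?thesis using spectral_norm_sq_le[of P] assms by (simp add: power2_eq_square)
qed simp

lemma spectral_norm_uminus [simp]: "spectral_norm (- A) = spectral_norm A"
proof -
  have "vec_norm2 (- A *\<^sub>v x) = vec_norm2 (A *\<^sub>v x)" if "x \<in> carrier_vec (dim_col A)" for x
  proof -
    have "(- A *\<^sub>v x) = (-1) \<cdot>\<^sub>v (A *\<^sub>v x)"
      using that by (intro eq_vecI) (auto simp: scalar_prod_def sum_negf)
    then show ?thesis by (simp add: vec_norm2_smult)
  qed
  then show ?thesis unfolding spectral_norm_def
    by (intro arg_cong[where f = Sup] Collect_cong) (metis index_uminus_mat(3))
qed

text \<open>The hypothesis says that the row spaces are orthogonal, so Pythagoras holds for the
  images of each vector under the transposes. Summed over unit vectors it is an equality of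
  Frobenius norms; for the spectral norm only an inequality remains, since different vectors may
  attain the suprema.\<close>

lemma norm_sq_add_orthogonal_le:
  assumes N: "N \<in> {spectral_norm, frobenius_norm}"
    and X: "X \<in> carrier_mat r c" and Y: "Y \<in> carrier_mat r c"
    and orth: "X * transpose_mat Y = 0\<^sub>m r r"
  shows "(N (X + Y))\<^sup>2 \<le> (N X)\<^sup>2 + (N Y)\<^sup>2"
proof -
  let ?X = "transpose_mat X" and ?Y = "transpose_mat Y" and ?S = "transpose_mat (X + Y)"
  have pyth: "(vec_norm2 (?S *\<^sub>v x))\<^sup>2 = (vec_norm2 (?X *\<^sub>v x))\<^sup>2 + (vec_norm2 (?Y *\<^sub>v x))\<^sup>2"
    if x: "x \<in> carrier_vec r" for x
  proof -
    let ?a = "?X *\<^sub>v x" and ?b = "?Y *\<^sub>v x"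
    have a: "?a \<in> carrier_vec c" and b: "?b \<in> carrier_vec c" using X Y x by auto
    have "?a \<bullet> ?b = x \<bullet> (X *\<^sub>v ?b)"
      using transpose_vec_mult_scalar[OF X b x] .
    also have "X *\<^sub>v ?b = (X * ?Y) *\<^sub>v x"
      using X Y x by (intro assoc_mult_mat_vec[symmetric]) auto
    also have "\<dots> = 0\<^sub>v r" unfolding orth using x by (intro eq_vecI) auto
    also have "x \<bullet> \<dots> = 0" using x by simp
    finally have ab: "?a \<bullet> ?b = 0" .
    have "?S *\<^sub>v x = ?a + ?b"
      using X Y x by (simp add: transpose_add add_mult_distrib_mat_vec[of _ c r])
    then have "(vec_norm2 (?S *\<^sub>v x))\<^sup>2 = (?a + ?b) \<bullet> (?a + ?b)" by (simp add: vec_norm2_sq)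
    also have "\<dots> = ?a \<bullet> ?a + ?b \<bullet> ?b"
      using ab comm_scalar_prod[OF a b] a b
      by (simp add: add_scalar_prod_distrib[of _ c] scalar_prod_add_distrib[of _ c])
    finally show ?thesis by (simp add: vec_norm2_sq)
  qed
  have "(frobenius_norm ?S)\<^sup>2 = (frobenius_norm ?X)\<^sup>2 + (frobenius_norm ?Y)\<^sup>2"
    unfolding frobenius_norm_sq_cols using X Y pyth by (simp add: sum.distrib)
  moreover have "(spectral_norm ?S)\<^sup>2 \<le> (spectral_norm ?X)\<^sup>2 + (spectral_norm ?Y)\<^sup>2"
  proof -
    let ?s = "sqrt ((spectral_norm ?X)\<^sup>2 + (spectral_norm ?Y)\<^sup>2)"
    have "spectral_norm ?S \<le> ?s"
    proof (rule spectral_norm_le)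
      fix x :: "real vec" assume "x \<in> carrier_vec (dim_col ?S)"
      then have x: "x \<in> carrier_vec r" using X Y by simp
      have "(vec_norm2 (?S *\<^sub>v x))\<^sup>2
          \<le> (spectral_norm ?X * vec_norm2 x)\<^sup>2 + (spectral_norm ?Y * vec_norm2 x)\<^sup>2"
        unfolding pyth[OF x]
        by (intro add_mono power_mono spectral_norm_mult_vec) (use X Y x in auto)
      also have "\<dots> = (?s * vec_norm2 x)\<^sup>2"
        by (simp add: power_mult_distrib algebra_simps)
      finally show "vec_norm2 (?S *\<^sub>v x) \<le> ?s * vec_norm2 x"
        by (rule power2_le_imp_le) simp
    qed simp
    then have "(spectral_norm ?S)\<^sup>2 \<le> ?s\<^sup>2" by (intro power_mono) auto
    then show ?thesis by simp
  qed
  ultimately have "(N ?S)\<^sup>2 \<le> (N ?X)\<^sup>2 + (N ?Y)\<^sup>2" using N by auto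
  then show ?thesis by (simp add: norm_transpose[OF N])
qed

section \<open>Diagonalization of real symmetric matrices\<close>

text \<open>A complex eigenvector always exists. Symmetry forces its eigenvalue to be real, and then
  its real or its imaginary part, whichever is nonzero, is a real eigenvector that can be
  normalized.\<close>

lemma symmetric_real_eigenvector:
  fixes M :: "real mat"
  assumes M: "M \<in> carrier_mat n n" and sym: "transpose_mat M = M" and n: "0 < n"
  obtains v e where "v \<in> carrier_vec n" and "v \<bullet> v = 1" and "M *\<^sub>v v = e \<cdot>\<^sub>v v"
proof -
  let ?C = "map_mat complex_of_real M"
  have C: "?C \<in> carrier_mat n n" using M by simp
  obtain z where "eigenvalue ?C z"
    using spectrum_non_empty[OF C n] unfolding spectrum_def by auto
  then obtain w where w: "w \<in> carrier_vec n" "w \<noteq> 0\<^sub>v n" and ev: "?C *\<^sub>v w = z \<cdot>\<^sub>v w"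
    unfolding eigenvalue_def eigenvector_def using C by auto
  define a where "a = map_vec Re w"
  define b where "b = map_vec Im w"
  have a: "a \<in> carrier_vec n" and b: "b \<in> carrier_vec n" using w by (auto simp: a_def b_def)
  have entry: "(\<Sum>j<n. complex_of_real (M $$ (i, j)) * w $ j) = z * w $ i" if "i < n" for i
    using arg_cong[OF ev, of "\<lambda>x. x $ i"] that M w
    by (simp add: scalar_prod_def atLeast0LessThan)
  have Ma: "M *\<^sub>v a = Re z \<cdot>\<^sub>v a - Im z \<cdot>\<^sub>v b"
  proof (rule eq_vecI)
    fix i assume "i < dim_vec (Re z \<cdot>\<^sub>v a - Im z \<cdot>\<^sub>v b)"
    then have i: "i < n" using b by simp
    show "(M *\<^sub>v a) $ i = (Re z \<cdot>\<^sub>v a - Im z \<cdot>\<^sub>v b) $ i"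
      using arg_cong[OF entry[OF i], of Re] i M w
      by (simp add: scalar_prod_def atLeast0LessThan a_def b_def)
  qed (use M a b in simp)
  have Mb: "M *\<^sub>v b = Im z \<cdot>\<^sub>v a + Re z \<cdot>\<^sub>v b"
  proof (rule eq_vecI)
    fix i assume "i < dim_vec (Im z \<cdot>\<^sub>v a + Re z \<cdot>\<^sub>v b)"
    then have i: "i < n" using b by simp
    show "(M *\<^sub>v b) $ i = (Im z \<cdot>\<^sub>v a + Re z \<cdot>\<^sub>v b) $ i"
      using arg_cong[OF entry[OF i], of Im] i M w
      by (simp add: scalar_prod_def atLeast0LessThan a_def b_def)
  qed (use M a b in simp)
  have ab_nz: "a \<noteq> 0\<^sub>v n \<or> b \<noteq> 0\<^sub>v n"
  proof (rule ccontr)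
    assume "\<not> ?thesis"
    then have "Re (w $ i) = 0 \<and> Im (w $ i) = 0" if "i < n" for i
      using that w by (metis a_def b_def carrier_vecD index_map_vec(1) index_zero_vec(1))
    then have "w = 0\<^sub>v n" using w by (intro eq_vecI) (auto simp: complex_eq_iff)
    then show False using w by simp
  qed
  have "(M *\<^sub>v a) \<bullet> b = a \<bullet> (M *\<^sub>v b)"
    using scalar_prod_transpose[OF M a b] sym by simp
  \<comment> \<open>Both sides are expanded by \<open>Ma\<close> and \<open>Mb\<close>; the terms
    with \<open>Re z\<close> cancel.\<close>
  then have "Im z * (a \<bullet> a + b \<bullet> b) = 0"
    using a b comm_scalar_prod[OF a b] unfolding Ma Mb
    by (simp add: minus_scalar_prod_distrib[of _ n] scalar_prod_add_distrib[of _ n] algebra_simps)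
  moreover have "a \<bullet> a + b \<bullet> b \<noteq> 0"
    using ab_nz scalar_prod_self_eq_0[OF a] scalar_prod_self_eq_0[OF b]
      scalar_prod_self_nonneg[of a] scalar_prod_self_nonneg[of b] by linarith
  ultimately have "Im z = 0" by simp
  then have "M *\<^sub>v a = Re z \<cdot>\<^sub>v a" "M *\<^sub>v b = Re z \<cdot>\<^sub>v b"
    using a b by (auto simp: Ma Mb)
  then obtain u where u: "u \<in> carrier_vec n" "u \<noteq> 0\<^sub>v n" and Mu: "M *\<^sub>v u = Re z \<cdot>\<^sub>v u"
    using ab_nz a b by blast
  have "0 < u \<bullet> u"
    using scalar_prod_self_eq_0[OF u(1)] u(2) scalar_prod_self_nonneg[of u] by linarith
  let ?s = "inverse (sqrt (u \<bullet> u))"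
  have "(?s \<cdot>\<^sub>v u) \<bullet> (?s \<cdot>\<^sub>v u) = ?s\<^sup>2 * (u \<bullet> u)"
    using u by (simp add: power2_eq_square)
  also have "\<dots> = 1" using \<open>0 < u \<bullet> u\<close> by (simp add: power_inverse)
  finally show ?thesis
    using that[of "?s \<cdot>\<^sub>v u" "Re z"] u Mu mult_mat_vec[OF M u(1), of ?s]
    by (simp add: smult_smult_assoc mult.commute)
qed

text \<open>The reflection in the hyperplane orthogonal to \<open>unit_vec n 0 - v\<close> exchanges
  these two unit vectors. It serves to move an eigenvector into the first coordinate
  direction.\<close>

lemma householder_reflection:
  fixes v :: "real vec"
  assumes v: "v \<in> carrier_vec n" and unit: "v \<bullet> v = 1" and n: "0 < n"
  obtains H where "H \<in> carrier_mat n n" and "transpose_mat H = H" and "H * H = 1\<^sub>m n"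
    and "H *\<^sub>v unit_vec n 0 = v"
proof -
  define w where "w = unit_vec n 0 - v"
  \<comment> \<open>For \<open>w = 0\<close> the quotient is 0, and \<open>H\<close> is the identity.\<close>
  define c where "c = 2 / (w \<bullet> w)"
  define H where "H = mat n n (\<lambda>(i, j). (if i = j then 1 else 0) - c * w $ i * w $ j)"
  have w: "w \<in> carrier_vec n" using v by (simp add: w_def)
  have ww: "(\<Sum>k<n. w $ k * w $ k) = w \<bullet> w"
    using w by (simp add: scalar_prod_def atLeast0LessThan)
  \<comment> \<open>This cancels the mixed and the quadratic term in the square of
    \<open>1 - c w w^T\<close>, making \<open>H\<close> an involution.\<close>
  have cc: "c\<^sup>2 * (w \<bullet> w) = 2 * c"
    by (cases "w \<bullet> w = 0") (simp_all add: c_def power2_eq_square)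
  have "H * H = 1\<^sub>m n"
  proof (rule eq_matI)
    fix i j assume "i < dim_row (1\<^sub>m n :: real mat)" "j < dim_col (1\<^sub>m n :: real mat)"
    then have i: "i < n" and j: "j < n" by auto
    have "(H * H) $$ (i, j) = (\<Sum>k<n. ((if i = k then 1 else 0) - c * w $ i * w $ k)
        * ((if k = j then 1 else 0) - c * w $ k * w $ j))"
      using i j by (simp add: H_def scalar_prod_def atLeast0LessThan)
    also have "\<dots> = (\<Sum>k<n. (if i = k then (if i = j then 1 else 0) - c * w $ i * w $ j else 0)
        - (if k = j then c * w $ i * w $ j else 0) + c\<^sup>2 * w $ i * w $ j * (w $ k * w $ k))"
      by (intro sum.cong) (auto simp: algebra_simps power2_eq_square)
    also have "\<dots> = ((if i = j then 1 else 0) - c * w $ i * w $ j) - c * w $ i * w $ j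
        + c\<^sup>2 * w $ i * w $ j * (w \<bullet> w)"
      using i j by (simp add: sum.distrib sum_subtractf ww flip: sum_distrib_left)
    also have "\<dots> = (if i = j then 1 else 0) + w $ i * w $ j * (c\<^sup>2 * (w \<bullet> w) - 2 * c)"
      by (simp add: algebra_simps)
    finally show "(H * H) $$ (i, j) = 1\<^sub>m n $$ (i, j)" using i j by (simp add: cc)
  qed (auto simp: H_def)
  moreover have "H *\<^sub>v unit_vec n 0 = v"
  proof -
    let ?e = "unit_vec n 0 :: real vec"
    have e: "?e \<in> carrier_vec n" by simp
    have ev: "?e \<bullet> v = v $ 0" "v \<bullet> ?e = v $ 0" "?e \<bullet> ?e = 1"
      using v n by (simp_all add: scalar_prod_left_unit scalar_prod_right_unit)
    \<comment> \<open>Since \<open>v\<close> is a unit vector, both sides equal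
      \<open>2 - 2 * v $ 0\<close>. Thus \<open>c * w $ 0 = 1\<close> for nonzero \<open>w\<close>,
      and \<open>H\<close> subtracts exactly \<open>w\<close> from the first unit vector.\<close>
    have "w \<bullet> w = 2 * w $ 0"
      using v n unit ev unfolding w_def
      by (simp add: minus_scalar_prod_distrib[OF e v] scalar_prod_minus_distrib[of _ n])
    then have c0: "w \<bullet> w \<noteq> 0 \<Longrightarrow> c * w $ 0 = 1" by (simp add: c_def)
    show ?thesis
    proof (rule eq_vecI)
      fix i assume "i < dim_vec v"
      then have i: "i < n" using v by simp
      have "(H *\<^sub>v ?e) $ i = (if i = 0 then 1 else 0) - c * w $ 0 * w $ i"
        using i n by (simp add: H_def scalar_prod_right_unit)
      also have "c * w $ 0 * w $ i = w $ i"
        using c0 scalar_prod_self_eq_0[OF w] i by (cases "w \<bullet> w = 0") auto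
      finally show "(H *\<^sub>v ?e) $ i = v $ i" using i v by (simp add: w_def)
    qed (use v in \<open>simp add: H_def\<close>)
  qed
  moreover have "transpose_mat H = H"
    unfolding H_def by (intro eq_matI) auto
  ultimately show ?thesis using that[of H] by (simp add: H_def)
qed

text \<open>Deflation: conjugating by a Householder reflection makes the first unit vector an
  eigenvector, symmetry then clears the first row as well as the first column, and the induction
  hypothesis treats the remaining block.\<close>

theorem real_symmetric_diagonalization:
  fixes M :: "real mat"
  assumes "M \<in> carrier_mat n n" and "transpose_mat M = M"
  shows "\<exists>Q D. orthonormal_mat n Q \<and> D \<in> carrier_mat n n \<and> diagonal_mat D
    \<and> M = Q * D * transpose_mat Q"
  using assms
proof (induction n arbitrary: M)
  case 0
  then have "M = 1\<^sub>m 0 * M * transpose_mat (1\<^sub>m 0)" by auto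
  then show ?case
    using 0 by (intro exI[of _ "1\<^sub>m 0"] exI[of _ M]) (auto simp: orthonormal_mat_def diagonal_mat_def)
next
  case (Suc n)
  note M = Suc.prems(1)
  obtain v e where v: "v \<in> carrier_vec (Suc n)" "v \<bullet> v = 1" and Mv: "M *\<^sub>v v = e \<cdot>\<^sub>v v"
    using symmetric_real_eigenvector[OF Suc.prems] by auto
  obtain H where H: "H \<in> carrier_mat (Suc n) (Suc n)" and Hsym: "transpose_mat H = H"
    and HH: "H * H = 1\<^sub>m (Suc n)" and He: "H *\<^sub>v unit_vec (Suc n) 0 = v"
    using householder_reflection[OF v] by auto
  define B where "B = H * M * H"
  have B: "B \<in> carrier_mat (Suc n) (Suc n)" using H M by (simp add: B_def)
  note assoc = assoc_mult_mat[of _ "Suc n" "Suc n" _ "Suc n" _ "Suc n"]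
  have Bsym: "transpose_mat B = B"
    using H M by (simp add: B_def transpose_mult[of _ "Suc n" "Suc n" _ "Suc n"] Hsym Suc.prems(2) assoc)
  have Hv: "H *\<^sub>v v = unit_vec (Suc n) 0"
    using assoc_mult_mat_vec[OF H H unit_vec_carrier[of "Suc n" 0]] by (simp add: HH He)
  have Be: "B *\<^sub>v unit_vec (Suc n) 0 = e \<cdot>\<^sub>v unit_vec (Suc n) 0"
  proof -
    have "B *\<^sub>v unit_vec (Suc n) 0 = H *\<^sub>v (M *\<^sub>v (H *\<^sub>v unit_vec (Suc n) 0))"
      using H M by (simp add: B_def assoc_mult_mat_vec[of _ "Suc n" "Suc n" _ "Suc n"])
    then show ?thesis using mult_mat_vec[OF H v(1)] by (simp add: He Mv Hv)
  qed
  have col0: "B $$ (i, 0) = (if i = 0 then e else 0)" if "i < Suc n" for i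
    using arg_cong[OF Be, of "\<lambda>x. x $ i"] that B by (simp add: scalar_prod_right_unit)
  have row0: "B $$ (0, i) = (if i = 0 then e else 0)" if "i < Suc n" for i
    using col0[OF that] that B Bsym by (metis carrier_matD(1,2) index_transpose_mat(1) zero_less_Suc)
  define B' where "B' = mat n n (\<lambda>(i, j). B $$ (Suc i, Suc j))"
  have "B' \<in> carrier_mat n n" by (simp add: B'_def)
  moreover have "transpose_mat B' = B'"
  proof (rule eq_matI)
    fix i j assume "i < dim_row B'" "j < dim_col B'"
    then show "transpose_mat B' $$ (i, j) = B' $$ (i, j)"
      using B Bsym by (auto simp: B'_def) (metis Suc_less_eq carrier_matD(1,2) index_transpose_mat(1))
  qed (auto simp: B'_def)
  ultimately obtain Q' D' where Q': "orthonormal_mat n Q'" and D': "D' \<in> carrier_mat n n"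
    and diag: "diagonal_mat D'" and B'_eq: "B' = Q' * D' * transpose_mat Q'"
    using Suc.IH by blast
  have Q'c: "Q' \<in> carrier_mat n n" and Q'1: "transpose_mat Q' * Q' = 1\<^sub>m n" "Q' * transpose_mat Q' = 1\<^sub>m n"
    using Q' by (auto simp: orthonormal_mat_def)
  \<comment> \<open>The direct sum of the scalar \<open>x\<close> and the matrix \<open>X\<close>.
    Products and transposes act blockwise on it, which lifts the diagonalization of
    \<open>B'\<close> to \<open>B\<close>.\<close>
  let ?blk = "\<lambda>x (X :: real mat). four_block_mat (x \<cdot>\<^sub>m 1\<^sub>m 1) (0\<^sub>m 1 n) (0\<^sub>m n 1) X"
  have blk_carrier: "?blk x X \<in> carrier_mat (Suc n) (Suc n)" if "X \<in> carrier_mat n n" for x X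
    using four_block_carrier_mat[of "x \<cdot>\<^sub>m 1\<^sub>m 1" 1 1 X n n] that by simp
  have blk_mult: "?blk x X * ?blk y Y = ?blk (x * y) (X * Y)"
    if "X \<in> carrier_mat n n" "Y \<in> carrier_mat n n" for x y X Y
    using that by (subst mult_four_block_mat[of _ 1 1 _ n _ n]) (auto intro!: cong_four_block_mat)
  have blk_transpose: "transpose_mat (?blk x X) = ?blk x (transpose_mat X)"
    if "X \<in> carrier_mat n n" for x X
    using that by (subst transpose_four_block_mat[of _ 1 1 _ n _ n]) (auto intro!: cong_four_block_mat)
  have blk_one: "?blk 1 (1\<^sub>m n) = 1\<^sub>m (Suc n)"
    by (intro eq_matI) auto
  define K where "K = ?blk 1 Q'"
  define D where "D = ?blk e D'"
  have K: "K \<in> carrier_mat (Suc n) (Suc n)" and D: "D \<in> carrier_mat (Suc n) (Suc n)"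
    using blk_carrier Q'c D' by (auto simp: K_def D_def)
  have Kt: "transpose_mat K = ?blk 1 (transpose_mat Q')"
    unfolding K_def by (rule blk_transpose[OF Q'c])
  have KtK: "transpose_mat K * K = 1\<^sub>m (Suc n)" and KKt: "K * transpose_mat K = 1\<^sub>m (Suc n)"
    unfolding Kt unfolding K_def using Q'c Q'1 blk_one by (simp_all add: blk_mult del: One_nat_def)
  have "B = ?blk e B'"
  proof (rule eq_matI)
    fix i j assume "i < dim_row (?blk e B')" "j < dim_col (?blk e B')"
    then have "i < Suc n" "j < Suc n" by (auto simp: B'_def)
    then show "B $$ (i, j) = ?blk e B' $$ (i, j)"
      using col0 row0 by (cases i; cases j) (auto simp: B'_def)
  qed (use B in \<open>auto simp: B'_def\<close>)
  also have "\<dots> = K * D * transpose_mat K"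
    unfolding Kt unfolding K_def D_def B'_eq using Q'c D' by (simp add: blk_mult del: One_nat_def)
  finally have BK: "B = K * D * transpose_mat K" .
  have "H * B * H = (H * H) * M * (H * H)"
    using H M by (simp add: B_def assoc)
  then have MB: "M = H * B * H" using M by (simp add: HH)
  have HKt: "transpose_mat (H * K) = transpose_mat K * H"
    using transpose_mult[OF H K] Hsym by simp
  have "M = (H * K) * D * transpose_mat (H * K)"
    unfolding HKt unfolding MB BK using H K D by (simp add: assoc)
  moreover have "orthonormal_mat (Suc n) (H * K)"
  proof -
    have "(transpose_mat K * H) * (H * K) = transpose_mat K * ((H * H) * K)"
      using H K by (simp add: assoc)
    moreover have "(H * K) * (transpose_mat K * H) = H * ((K * transpose_mat K) * H)"
      using H K by (simp add: assoc)
    ultimately show ?thesis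
      unfolding orthonormal_mat_def HKt using H K by (simp add: HH KtK KKt)
  qed
  moreover have "diagonal_mat D"
    using diag D' unfolding diagonal_mat_def D_def by (auto simp: less_Suc_eq_0_disj) blast
  ultimately show ?case using D by blast
qed

section \<open>Positive semidefinite square roots\<close>

text \<open>The form of the congruent matrix at \<open>x\<close> is the form of \<open>M\<close> at
  \<open>transpose_mat Q *\<^sub>v x\<close>. It is used to pass both into and out of an
  eigenbasis.\<close>

lemma psd_mat_congruence:
  assumes "psd_mat M" and M: "M \<in> carrier_mat n n" and Q: "Q \<in> carrier_mat r n"
  shows "psd_mat (Q * M * transpose_mat Q)"
proof -
  have sym: "transpose_mat M = M" and pos: "\<And>x. x \<in> carrier_vec n \<Longrightarrow> 0 \<le> x \<bullet> (M *\<^sub>v x)"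
    using assms(1) M by (auto simp: psd_mat_def)
  have "transpose_mat (Q * M * transpose_mat Q) = Q * M * transpose_mat Q"
  proof -
    have "transpose_mat (Q * M * transpose_mat Q) = transpose_mat (transpose_mat Q) * transpose_mat (Q * M)"
      using M Q by (intro transpose_mult[of _ r n _ r]) auto
    also have "transpose_mat (Q * M) = M * transpose_mat Q"
      using transpose_mult[OF Q M] sym by simp
    finally show ?thesis using M Q by (simp add: assoc_mult_mat[of _ r n _ n _ r])
  qed
  moreover have "0 \<le> x \<bullet> (Q * M * transpose_mat Q *\<^sub>v x)" if x: "x \<in> carrier_vec r" for x
  proof -
    have "Q * M * transpose_mat Q *\<^sub>v x = Q *\<^sub>v (M *\<^sub>v (transpose_mat Q *\<^sub>v x))"
      using M Q x by (simp add: assoc_mult_mat_vec[of _ r n _ r] assoc_mult_mat_vec[of _ r n _ n])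
    moreover have "x \<bullet> \<dots> = (transpose_mat Q *\<^sub>v x) \<bullet> (M *\<^sub>v (transpose_mat Q *\<^sub>v x))"
      using M Q x by (intro transpose_vec_mult_scalar[symmetric]) auto
    ultimately show ?thesis using pos M Q x by simp
  qed
  ultimately show ?thesis using M Q by (simp add: psd_mat_def)
qed

lemma psd_mat_diagonal_entry:
  assumes "psd_mat D" and D: "D \<in> carrier_mat n n" and i: "i < n"
  shows "0 \<le> D $$ (i, i)"
proof -
  have "0 \<le> unit_vec n i \<bullet> (D *\<^sub>v unit_vec n i)"
    using assms(1) D unfolding psd_mat_def by (metis carrier_matD(1) unit_vec_carrier)
  then show ?thesis using D i by (simp add: scalar_prod_left_unit scalar_prod_right_unit)
qed

text \<open>In an orthonormal eigenbasis the square roots of the eigenvalues are taken.\<close>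

lemma psd_sqrt_exists:
  assumes psd: "psd_mat M" and M: "M \<in> carrier_mat n n"
  shows "\<exists>X. X \<in> carrier_mat n n \<and> psd_mat X \<and> X * X = M"
proof -
  have "transpose_mat M = M" using psd by (simp add: psd_mat_def)
  then obtain Q D where "orthonormal_mat n Q" and D: "D \<in> carrier_mat n n" "diagonal_mat D"
    and MD: "M = Q * D * transpose_mat Q"
    using real_symmetric_diagonalization[OF M] by blast
  then have Q: "Q \<in> carrier_mat n n" "transpose_mat Q * Q = 1\<^sub>m n" "Q * transpose_mat Q = 1\<^sub>m n"
    by (auto simp: orthonormal_mat_def)
  note assoc = assoc_mult_mat[of _ n n _ n _ n]
  \<comment> \<open>\<open>D\<close> is in turn congruent to \<open>M\<close>, hence positive
    semidefinite, so its diagonal has real square roots.\<close>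
  have "transpose_mat Q * M * Q = (transpose_mat Q * Q) * D * (transpose_mat Q * Q)"
    unfolding MD using Q(1) D by (simp add: assoc)
  then have "transpose_mat Q * M * transpose_mat (transpose_mat Q) = D" using Q D by simp
  then have "psd_mat D" using psd_mat_congruence[OF psd M, of "transpose_mat Q" n] Q by simp
  then have D_nonneg: "0 \<le> D $$ (i, i)" if "i < n" for i
    using psd_mat_diagonal_entry D that by blast
  define E where "E = mat n n (\<lambda>(i, j). if i = j then sqrt (D $$ (i, i)) else 0)"
  have E: "E \<in> carrier_mat n n" by (simp add: E_def)
  have Ex: "(E *\<^sub>v x) $ i = sqrt (D $$ (i, i)) * x $ i" if "x \<in> carrier_vec n" "i < n" for x i
    using that by (simp add: E_def scalar_prod_def if_distrib[of "\<lambda>y. y * _"] cong: if_cong)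
  have EE: "E * E = D"
  proof (rule eq_matI)
    fix i j assume "i < dim_row D" "j < dim_col D"
    then have ij: "i < n" "j < n" using D by auto
    have "(E * E) $$ (i, j) = (E *\<^sub>v col E j) $ i" using ij E by simp
    also have "\<dots> = sqrt (D $$ (i, i)) * E $$ (i, j)" using ij E by (subst Ex) auto
    finally show "(E * E) $$ (i, j) = D $$ (i, j)"
      using ij D D_nonneg by (auto simp: E_def diagonal_mat_def)
  qed (use D E in auto)
  have "0 \<le> x \<bullet> (E *\<^sub>v x)" if x: "x \<in> carrier_vec n" for x
  proof -
    have "x \<bullet> (E *\<^sub>v x) = (\<Sum>i<n. sqrt (D $$ (i, i)) * (x $ i * x $ i))"
      unfolding scalar_prod_def[of x] using E x
      by (intro sum.cong) (auto simp: Ex[OF x] simp del: index_mult_mat_vec)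
    then show ?thesis using D_nonneg by (auto intro!: sum_nonneg)
  qed
  moreover have "transpose_mat E = E" unfolding E_def by (intro eq_matI) auto
  ultimately have "psd_mat E" using E by (auto simp: psd_mat_def)
  then have "psd_mat (Q * E * transpose_mat Q)" by (rule psd_mat_congruence[OF _ E Q(1)])
  moreover have "(Q * E * transpose_mat Q) * (Q * E * transpose_mat Q)
      = Q * E * (transpose_mat Q * Q) * E * transpose_mat Q"
    using Q(1) E by (simp add: assoc)
  then have "(Q * E * transpose_mat Q) * (Q * E * transpose_mat Q) = M"
    using Q E by (simp add: MD EE assoc flip: EE)
  ultimately show ?thesis using Q E by (intro exI[of _ "Q * E * transpose_mat Q"]) auto
qed

text \<open>If \<open>q\<close> is an eigenvector of \<open>X - Y\<close> with eigenvalue \<open>e\<close>, then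
  \<open>0 = q \<bullet> (X\<^sup>2 - Y\<^sup>2) q = e (q \<bullet> X q + q \<bullet> Y q)\<close>, while \<open>e (q \<bullet> q) = q \<bullet> X q - q \<bullet> Y q\<close>;
  hence \<open>e = 0\<close>.\<close>

lemma psd_sqrt_unique:
  assumes "psd_mat X" and X: "X \<in> carrier_mat n n" and "psd_mat Y" and Y: "Y \<in> carrier_mat n n"
    and eq: "X * X = Y * Y"
  shows "X = Y"
proof -
  have Xs: "transpose_mat X = X" and Xpos: "\<And>x. x \<in> carrier_vec n \<Longrightarrow> 0 \<le> x \<bullet> (X *\<^sub>v x)"
    using assms(1) X by (auto simp: psd_mat_def)
  have Ys: "transpose_mat Y = Y" and Ypos: "\<And>x. x \<in> carrier_vec n \<Longrightarrow> 0 \<le> x \<bullet> (Y *\<^sub>v x)"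
    using assms(3) Y by (auto simp: psd_mat_def)
  let ?D = "X - Y"
  have Dc: "?D \<in> carrier_mat n n" using X Y by (simp add: minus_carrier_mat)
  have "transpose_mat ?D = ?D" using transpose_minus[OF X Y] Xs Ys by simp
  then obtain Q E where "orthonormal_mat n Q" and E: "E \<in> carrier_mat n n" "diagonal_mat E"
    and DE: "?D = Q * E * transpose_mat Q"
    using real_symmetric_diagonalization[OF Dc] by blast
  then have Q: "Q \<in> carrier_mat n n" "transpose_mat Q * Q = 1\<^sub>m n"
    by (auto simp: orthonormal_mat_def)
  have "E $$ (i, i) = 0" if i: "i < n" for i
  proof -
    let ?q = "col Q i" and ?e = "E $$ (i, i)"
    have q: "?q \<in> carrier_vec n" using Q by auto
    have qq: "?q \<bullet> ?q = 1"
      using arg_cong[OF Q(2), of "\<lambda>A. A $$ (i, i)"] Q(1) i by simp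
    have "?D * Q = Q * E * (transpose_mat Q * Q)"
      unfolding DE using Q(1) E by (simp add: assoc_mult_mat[of _ n n _ n _ n])
    then have DQ: "?D * Q = Q * E" using Q E by simp
    have "?D *\<^sub>v ?q = col (?D * Q) i" using Dc Q i by (intro eq_vecI) auto
    also have "\<dots> = ?e \<cdot>\<^sub>v ?q"
    proof (rule eq_vecI)
      fix j assume "j < dim_vec (?e \<cdot>\<^sub>v ?q)"
      then have j: "j < n" using Q by simp
      have "col (?D * Q) i $ j = (\<Sum>l<n. Q $$ (j, l) * E $$ (l, i))"
        unfolding DQ using Q E i j by (simp add: scalar_prod_def atLeast0LessThan)
      also have "\<dots> = (\<Sum>l<n. if l = i then Q $$ (j, i) * ?e else 0)"
        using E i by (intro sum.cong) (auto simp: diagonal_mat_def)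
      finally show "col (?D * Q) i $ j = (?e \<cdot>\<^sub>v ?q) $ j" using Q i j by simp
    qed (use Dc Q in auto)
    finally have Dq: "X *\<^sub>v ?q - Y *\<^sub>v ?q = ?e \<cdot>\<^sub>v ?q"
      using minus_mult_distrib_mat_vec[OF X Y q] by simp
    have c: "X *\<^sub>v ?q \<in> carrier_vec n" "Y *\<^sub>v ?q \<in> carrier_vec n" using X Y q by auto
    have diff: "?q \<bullet> (X *\<^sub>v ?q) - ?q \<bullet> (Y *\<^sub>v ?q) = ?e"
      using arg_cong[OF Dq, of "\<lambda>u. ?q \<bullet> u"] q c by (simp add: scalar_prod_minus_distrib[of _ n] qq)
    have "X *\<^sub>v (X *\<^sub>v ?q) = Y *\<^sub>v (Y *\<^sub>v ?q)"
      using arg_cong[OF eq, of "\<lambda>A. A *\<^sub>v ?q"] X Y q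
      by (simp add: assoc_mult_mat_vec[of _ n n _ n])
    then have "?q \<bullet> (X *\<^sub>v (X *\<^sub>v ?q)) = ?q \<bullet> (Y *\<^sub>v (Y *\<^sub>v ?q))" by simp
    then have "(X *\<^sub>v ?q) \<bullet> (X *\<^sub>v ?q) = (Y *\<^sub>v ?q) \<bullet> (Y *\<^sub>v ?q)"
      using scalar_prod_transpose[OF X q c(1)] scalar_prod_transpose[OF Y q c(2)] by (simp add: Xs Ys)
    then have "(X *\<^sub>v ?q + Y *\<^sub>v ?q) \<bullet> (X *\<^sub>v ?q - Y *\<^sub>v ?q) = 0"
      using c comm_scalar_prod[OF c]
      by (simp add: add_scalar_prod_distrib[of _ n] scalar_prod_minus_distrib[of _ n] minus_carrier_vec)
    then have "?e * (?q \<bullet> (X *\<^sub>v ?q)) + ?e * (?q \<bullet> (Y *\<^sub>v ?q)) = 0"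
      unfolding Dq using c q comm_scalar_prod[OF c(1) q] comm_scalar_prod[OF c(2) q]
      by (simp add: add_scalar_prod_distrib[of _ n])
    then have "?e * (?q \<bullet> (X *\<^sub>v ?q) + ?q \<bullet> (Y *\<^sub>v ?q)) = 0"
      by (simp only: distrib_left)
    \<comment> \<open>If \<open>?e\<close> were nonzero, the two nonnegative forms would sum to 0,
      so both would vanish, and with them their difference \<open>?e\<close>.\<close>
    then show ?thesis
      using diff Xpos[OF q] Ypos[OF q] by auto
  qed
  then have "E = 0\<^sub>m n n" using E by (intro eq_matI) (auto simp: diagonal_mat_def)
  then have "?D = 0\<^sub>m n n" using DE Q by simp
  then show ?thesis
    using X Y by (intro eq_matI) (auto dest!: arg_cong[of ?D _ "\<lambda>A. A $$ _"] simp: mat_eq_iff)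
qed

lemma mat_sqrt_props:
  assumes "psd_mat M" and M: "M \<in> carrier_mat n n"
  shows "mat_sqrt M \<in> carrier_mat n n" and "psd_mat (mat_sqrt M)" and "mat_sqrt M * mat_sqrt M = M"
proof -
  have "\<exists>!X. X \<in> carrier_mat (dim_row M) (dim_row M) \<and> psd_mat X \<and> X * X = M"
    using psd_sqrt_exists[OF assms] psd_sqrt_unique[of _ n] M by (intro ex_ex1I) auto
  from theI'[OF this] M
  show "mat_sqrt M \<in> carrier_mat n n" "psd_mat (mat_sqrt M)" "mat_sqrt M * mat_sqrt M = M"
    unfolding mat_sqrt_def by auto
qed

section \<open>Moore-Penrose inverses of full rank matrices\<close>

text \<open>Realizes the rank by a concrete set of columns. As a set it counts repeated columns
  once, which is what detects repetitions in the full column rank case.\<close>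

lemma rank_maximal_indpt:
  fixes A :: "real mat"
  assumes A: "A \<in> carrier_mat r c"
  obtains S where "S \<subseteq> set (cols A)" and "\<not> LinearCombinations.module.lin_dep class_ring (module_vec TYPE(real) r) S"
    and "vec_space.rank r A = card S"
proof -
  interpret vec_space "TYPE(real)" r .
  have "\<exists>S. finite S \<and> maximal S (\<lambda>T. T \<subseteq> set (cols A) \<and> lin_indpt T) \<and> {} \<subseteq> S"
    by (rule maximal_exists_superset[of "set (cols A)"]) (auto simp: lin_dep_def)
  then obtain S where S: "maximal S (\<lambda>T. T \<subseteq> set (cols A) \<and> lin_indpt T)" by blast
  then have "S \<subseteq> set (cols A)" "lin_indpt S" by (auto simp: maximal_def)
  then show ?thesis using that rank_card_indpt[OF A S] by blast
qed

text \<open>Rank \<open>c\<close> leaves no room for repeated columns among the \<open>c\<close>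
  columns; a nonzero kernel vector would then be a linear dependency between them.\<close>

lemma full_col_rank_kernel:
  fixes A :: "real mat"
  assumes A: "A \<in> carrier_mat r c" and rank: "vec_space.rank r A = c"
    and x: "x \<in> carrier_vec c" and Ax: "A *\<^sub>v x = 0\<^sub>v r"
  shows "x = 0\<^sub>v c"
proof -
  interpret vec_space "TYPE(real)" r .
  obtain S where S: "S \<subseteq> set (cols A)" "rank A = card S" using rank_maximal_indpt[OF A] by blast
  have "card S \<le> card (set (cols A))" using S(1) by (intro card_mono) auto
  then have dist: "distinct (cols A)"
    using S(2) rank A card_length[of "cols A"] by (intro card_distinct) auto
  then show ?thesis
    using full_rank_lin_indpt[OF A rank dist] lin_depI[OF A x _ Ax dist] by blast
qed

text \<open>Some \<open>r\<close> independent columns form a nonsingular square matrix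
  \<open>B\<close>. A vector orthogonal to all columns of \<open>A\<close> is annihilated by
  \<open>transpose_mat B\<close>.\<close>

lemma full_row_rank_kernel:
  fixes A :: "real mat"
  assumes A: "A \<in> carrier_mat r c" and rank: "vec_space.rank r A = r"
    and y: "y \<in> carrier_vec r" and Ay: "transpose_mat A *\<^sub>v y = 0\<^sub>v c"
  shows "y = 0\<^sub>v r"
proof -
  interpret vec_space "TYPE(real)" r .
  obtain S where S: "S \<subseteq> set (cols A)" "lin_indpt S" and card: "card S = r"
    using rank_maximal_indpt[OF A] rank by metis
  have "finite S" using S(1) by (rule finite_subset) simp
  then obtain xs where xs: "set xs = S" "distinct xs" using finite_distinct_list by blast
  have len: "length xs = r" using xs card distinct_card by fastforce
  have sub: "set xs \<subseteq> carrier_vec r" using S(1) xs(1) A cols_dim[of A] by auto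
  define B where "B = mat_of_cols r xs"
  have B: "B \<in> carrier_mat r r" using len by (auto simp: B_def)
  have cols_B: "cols B = xs" using sub by (simp add: B_def)
  have "rank B = r" using lin_indpt_full_rank[OF B] cols_B xs S(2) by simp
  then have "det (transpose_mat B) \<noteq> 0"
    using det_rank_iff[OF B] det_transpose[OF B] by simp
  moreover have "transpose_mat B *\<^sub>v y = 0\<^sub>v r"
  proof (rule eq_vecI)
    fix i assume "i < dim_vec (0\<^sub>v r :: real vec)"
    then have i: "i < r" by simp
    then have "xs ! i \<in> set (cols A)" using len xs S(1) nth_mem by blast
    then obtain j where j: "j < c" "xs ! i = col A j"
      using A by (auto simp: cols_def)
    have "col B i = xs ! i" using cols_B i B by (metis cols_nth carrier_matD(2))
    then have "(transpose_mat B *\<^sub>v y) $ i = col A j \<bullet> y" using i B j by simp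
    also have "\<dots> = (transpose_mat A *\<^sub>v y) $ j" using A j by simp
    finally show "(transpose_mat B *\<^sub>v y) $ i = 0\<^sub>v r $ i" using Ay j i by simp
  qed (use B in simp)
  ultimately show ?thesis
    using det_0_iff_vec_prod_zero_field[of "transpose_mat B" r] B y by auto
qed

text \<open>The inverse is delivered as \<open>Some B\<close> because \<open>mat_inv_sqrt\<close>
  unwraps \<open>mat_inverse\<close> with \<open>the\<close>.\<close>

lemma mat_inverse_trivial_kernel:
  fixes A :: "real mat"
  assumes A: "A \<in> carrier_mat n n"
    and ker: "\<And>x. x \<in> carrier_vec n \<Longrightarrow> A *\<^sub>v x = 0\<^sub>v n \<Longrightarrow> x = 0\<^sub>v n"
  obtains B where "mat_inverse A = Some B" and "B \<in> carrier_mat n n"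
    and "A * B = 1\<^sub>m n" and "B * A = 1\<^sub>m n"
proof -
  have "det A \<noteq> 0" using det_0_iff_vec_prod_zero_field[OF A] ker by blast
  then have "A \<in> Units (ring_mat TYPE(real) n ())" by (rule det_non_zero_imp_unit[OF A])
  then obtain B where B: "mat_inverse A = Some B"
    using mat_inverse(1)[OF A, of "()"] by (cases "mat_inverse A") auto
  then show ?thesis using mat_inverse(2)[OF A B] that by blast
qed

text \<open>Transposing \<open>M * X = (M * Y) * (M * X)\<close> swaps the symmetric factors and
  yields \<open>M * X = M * Y\<close>; likewise \<open>X * M = Y * M\<close>. Then
  \<open>X = X * M * X = X * M * Y = Y * M * Y = Y\<close>.\<close>

lemma is_mp_inverse_unique:
  assumes "is_mp_inverse M X" and "is_mp_inverse M Y"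
  shows "X = Y"
proof -
  define r c where "r = dim_row M" and "c = dim_col M"
  have M: "M \<in> carrier_mat r c" unfolding r_def c_def by (rule carrier_matI[OF refl refl])
  have X: "X \<in> carrier_mat c r" "M * X * M = M" "X * M * X = X"
      "transpose_mat (M * X) = M * X" "transpose_mat (X * M) = X * M"
    and Y: "Y \<in> carrier_mat c r" "M * Y * M = M" "Y * M * Y = Y"
      "transpose_mat (M * Y) = M * Y" "transpose_mat (Y * M) = Y * M"
    using assms unfolding is_mp_inverse_def r_def c_def by blast+
  note assoc = assoc_mult_mat[of _ r c _ r _ r] assoc_mult_mat[of _ r c _ r _ c]
    assoc_mult_mat[of _ r c _ c _ r] assoc_mult_mat[of _ r c _ c _ c]
    assoc_mult_mat[of _ c r _ c _ c] assoc_mult_mat[of _ c r _ c _ r]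
    assoc_mult_mat[of _ c r _ r _ c] assoc_mult_mat[of _ c r _ r _ r]
    assoc_mult_mat[of _ r r _ c _ r] assoc_mult_mat[of _ r r _ r _ r]
    assoc_mult_mat[of _ c c _ r _ c] assoc_mult_mat[of _ c c _ c _ c]
  have "M * X = (M * Y * M) * X" by (simp add: Y)
  also have "\<dots> = (M * Y) * (M * X)"
    using M X(1) Y(1) by (simp add: assoc)
  finally have "transpose_mat (M * X) = transpose_mat ((M * Y) * (M * X))" by simp
  also have "\<dots> = transpose_mat (M * X) * transpose_mat (M * Y)"
    using M X(1) Y(1) by (intro transpose_mult[of _ r r _ r]) auto
  finally have "M * X = (M * X) * (M * Y)" by (simp add: X Y)
  also have "\<dots> = (M * X * M) * Y"
    using M X(1) Y(1) by (simp add: assoc)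
  finally have MX: "M * X = M * Y" by (simp add: X)
  have "X * M = X * (M * Y * M)" by (simp add: Y)
  also have "\<dots> = (X * M) * (Y * M)"
    using M X(1) Y(1) by (simp add: assoc)
  finally have "transpose_mat (X * M) = transpose_mat ((X * M) * (Y * M))" by simp
  also have "\<dots> = transpose_mat (Y * M) * transpose_mat (X * M)"
    using M X(1) Y(1) by (intro transpose_mult[of _ c c _ c]) auto
  finally have "X * M = (Y * M) * (X * M)" by (simp add: X Y)
  also have "\<dots> = Y * (M * X * M)"
    using M X(1) Y(1) by (simp add: assoc)
  finally have XM: "X * M = Y * M" by (simp add: X)
  have "X = X * (M * X)" using X M by (simp add: assoc)
  also have "\<dots> = (X * M) * Y" using X(1) Y(1) M by (simp add: MX assoc)
  also have "\<dots> = Y" by (simp add: XM Y)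
  finally show ?thesis .
qed

text \<open>Transposition exchanges the two symmetry equations. This reduces existence for full row
  rank to the case of a trivial kernel.\<close>

lemma is_mp_inverse_transpose:
  assumes "is_mp_inverse M X"
  shows "is_mp_inverse (transpose_mat M) (transpose_mat X)"
proof -
  define r c where "r = dim_row M" and "c = dim_col M"
  have M: "M \<in> carrier_mat r c" unfolding r_def c_def by (rule carrier_matI[OF refl refl])
  have X: "X \<in> carrier_mat c r" "M * X * M = M" "X * M * X = X"
      "transpose_mat (M * X) = M * X" "transpose_mat (X * M) = X * M"
    using assms unfolding is_mp_inverse_def r_def c_def by blast+
  have t: "transpose_mat M * transpose_mat X = X * M" "transpose_mat X * transpose_mat M = M * X"
    using X(4,5) transpose_mult[OF X(1) M] transpose_mult[OF M X(1)] by simp_all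
  have "transpose_mat M * transpose_mat X * transpose_mat M = transpose_mat M * (transpose_mat X * transpose_mat M)"
    using M X(1) by (intro assoc_mult_mat[of _ c r _ c _ r]) auto
  also have "\<dots> = transpose_mat (M * X * M)"
    unfolding t using transpose_mult[of "M * X" r r M c] M X(1,4) by simp
  finally have MXM: "transpose_mat M * transpose_mat X * transpose_mat M = transpose_mat M"
    by (simp only: X)
  have "transpose_mat X * transpose_mat M * transpose_mat X = transpose_mat X * (transpose_mat M * transpose_mat X)"
    using M X(1) by (intro assoc_mult_mat[of _ r c _ r _ c]) auto
  also have "\<dots> = transpose_mat (X * M * X)"
    unfolding t using transpose_mult[of "X * M" c c X r] M X(1,5) by simp
  finally have XMX: "transpose_mat X * transpose_mat M * transpose_mat X = transpose_mat X"
    by (simp only: X)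
  show ?thesis
    unfolding is_mp_inverse_def MXM XMX unfolding t X(4,5) using M X(1) by simp
qed

text \<open>The Gram matrix is nonsingular because its quadratic form is the squared norm of
  \<open>M *\<^sub>v x\<close>; the witness is the inverse of the Gram matrix times
  \<open>transpose_mat M\<close>, a left inverse of \<open>M\<close>.\<close>

lemma is_mp_inverse_trivial_kernel:
  assumes M: "M \<in> carrier_mat r c"
    and ker: "\<And>x. x \<in> carrier_vec c \<Longrightarrow> M *\<^sub>v x = 0\<^sub>v r \<Longrightarrow> x = 0\<^sub>v c"
  shows "\<exists>X. is_mp_inverse M X"
proof -
  let ?G = "transpose_mat M * M"
  have G: "?G \<in> carrier_mat c c" using M by simp
  have "x = 0\<^sub>v c" if x: "x \<in> carrier_vec c" and Gx: "?G *\<^sub>v x = 0\<^sub>v c" for x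
  proof (rule ker[OF x])
    have "(M *\<^sub>v x) \<bullet> (M *\<^sub>v x) = x \<bullet> (?G *\<^sub>v x)"
      using vec_norm2_sq_mult_mat_vec[OF M x] by (simp add: vec_norm2_sq)
    then show "M *\<^sub>v x = 0\<^sub>v r"
      using x M Gx by (intro scalar_prod_self_eq_0) auto
  qed
  then obtain B where B: "B \<in> carrier_mat c c" "?G * B = 1\<^sub>m c" "B * ?G = 1\<^sub>m c"
    using mat_inverse_trivial_kernel[OF G] by metis
  have Gs: "transpose_mat ?G = ?G" using M by (simp add: transpose_mult[of _ c r _ c])
  \<comment> \<open>The inverse of a symmetric matrix is symmetric: \<open>transpose_mat B\<close>
    is a left and \<open>B\<close> a right inverse of \<open>?G\<close>, so they agree.\<close>
  have "transpose_mat B * ?G = 1\<^sub>m c"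
    using transpose_mult[OF G B(1)] B(2) Gs by simp
  then have "transpose_mat B * ?G * B = B" using B(1) by simp
  then have Bs: "transpose_mat B = B"
    using assoc_mult_mat[of "transpose_mat B" c c ?G c B c] B G by simp
  let ?X = "B * transpose_mat M"
  have XM: "?X * M = 1\<^sub>m c" using B M by (simp add: assoc_mult_mat[of _ c c _ r _ c])
  have MXM: "M * ?X * M = M" using XM B(1) M by (simp add: assoc_mult_mat[of _ r c _ r _ c])
  have "transpose_mat ?X = M * B"
    using transpose_mult[of B c c "transpose_mat M" r] B M Bs by simp
  then have "transpose_mat (M * ?X) = M * ?X"
    using transpose_mult[of M r c ?X r] B M by (simp add: assoc_mult_mat[of _ r c _ c _ r])
  then show ?thesis
    using XM MXM M B(1) unfolding is_mp_inverse_def by (intro exI[of _ ?X]) auto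
qed

lemma mp_inverse_props:
  assumes "is_mp_inverse M X"
  shows "is_mp_inverse M (mp_inverse M)"
  unfolding mp_inverse_def
  by (rule theI[of _ X]) (use assms is_mp_inverse_unique in auto)

lemma is_mp_inverse_full_col_rank:
  assumes "M \<in> carrier_mat r c" and "mat_rank M = c"
  shows "is_mp_inverse M (mp_inverse M)"
proof -
  have "vec_space.rank r M = c" using assms by simp
  then obtain X where "is_mp_inverse M X"
    using is_mp_inverse_trivial_kernel[OF assms(1)] full_col_rank_kernel[OF assms(1)] by blast
  then show ?thesis by (rule mp_inverse_props)
qed

text \<open>Full row rank means that the transpose has trivial kernel, which gives existence by
  transposing. The Penrose equations also give \<open>transpose_mat M * (?P - 1) = 0\<close>, and
  the trivial kernel forces \<open>?P = 1\<close>.\<close>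

lemma mp_inverse_full_row_rank:
  assumes M: "M \<in> carrier_mat r c" and rank: "mat_rank M = r"
  shows "mp_inverse M \<in> carrier_mat c r" and "M * mp_inverse M = 1\<^sub>m r"
proof -
  have Mt: "transpose_mat M \<in> carrier_mat c r" using M by simp
  have ker: "\<And>y. y \<in> carrier_vec r \<Longrightarrow> transpose_mat M *\<^sub>v y = 0\<^sub>v c \<Longrightarrow> y = 0\<^sub>v r"
    using full_row_rank_kernel[OF M] rank M by simp
  then obtain X where "is_mp_inverse (transpose_mat M) X"
    using is_mp_inverse_trivial_kernel[OF Mt] by blast
  then have "is_mp_inverse M (transpose_mat X)"
    using is_mp_inverse_transpose by fastforce
  then have mp: "is_mp_inverse M (mp_inverse M)" by (rule mp_inverse_props)
  let ?P = "M * mp_inverse M"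
  show W: "mp_inverse M \<in> carrier_mat c r" using mp M by (simp add: is_mp_inverse_def)
  have P: "?P \<in> carrier_mat r r" using W M by simp
  have "?P * M = M" "transpose_mat ?P = ?P" using mp by (auto simp: is_mp_inverse_def)
  then have MtP: "transpose_mat M * ?P = transpose_mat M"
    using transpose_mult[OF P M] by simp
  show "?P = 1\<^sub>m r"
  proof (rule eq_matI)
    fix i j assume "i < dim_row (1\<^sub>m r :: real mat)" "j < dim_col (1\<^sub>m r :: real mat)"
    then have i: "i < r" and j: "j < r" by auto
    \<comment> \<open>Column \<open>j\<close> of \<open>?P - 1\<close>.\<close>
    let ?y = "?P *\<^sub>v unit_vec r j - unit_vec r j"
    have "transpose_mat M *\<^sub>v ?y
        = transpose_mat M * ?P *\<^sub>v unit_vec r j - transpose_mat M *\<^sub>v unit_vec r j"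
      using Mt P by (simp add: mult_minus_distrib_mat_vec[of _ c r] assoc_mult_mat_vec[of _ c r _ r])
    also have "\<dots> = 0\<^sub>v c" using Mt unfolding MtP by (intro eq_vecI) auto
    finally have "?y = 0\<^sub>v r" using P by (intro ker) (auto simp: minus_carrier_vec)
    then have "?y $ i = 0" using i by simp
    then have "(?P *\<^sub>v unit_vec r j) $ i = 1\<^sub>m r $$ (i, j)"
      using i j by (simp del: index_mult_mat_vec)
    moreover have "(?P *\<^sub>v unit_vec r j) $ i = row ?P i \<bullet> unit_vec r j"
      using M i by (intro index_mult_mat_vec) simp
    moreover have "row ?P i \<bullet> unit_vec r j = row ?P i $ j"
      using W j by (intro scalar_prod_right_unit) auto
    moreover have "row ?P i $ j = ?P $$ (i, j)"
      using M W i j by (intro index_row) auto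
    ultimately show "?P $$ (i, j) = 1\<^sub>m r $$ (i, j)" by simp
  qed (use P in auto)
qed

text \<open>These four facts are all that the main argument uses about
  \<open>range_proj Z\<close>.\<close>

lemma range_proj_complement:
  assumes Z: "Z \<in> carrier_mat n p" and mp: "is_mp_inverse Z (mp_inverse Z)"
  shows "1\<^sub>m n - range_proj Z \<in> carrier_mat n n"
    and "transpose_mat (1\<^sub>m n - range_proj Z) = 1\<^sub>m n - range_proj Z"
    and "(1\<^sub>m n - range_proj Z) * (1\<^sub>m n - range_proj Z) = 1\<^sub>m n - range_proj Z"
    and "(1\<^sub>m n - range_proj Z) * Z = 0\<^sub>m n p"
proof -
  let ?P = "range_proj Z"
  have X: "mp_inverse Z \<in> carrier_mat p n" using mp Z by (simp add: is_mp_inverse_def)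
  have P: "?P \<in> carrier_mat n n" using X Z by (simp add: range_proj_def)
  have Pt: "transpose_mat ?P = ?P" and PZ: "?P * Z = Z"
    using mp by (auto simp: is_mp_inverse_def range_proj_def)
  have "?P * ?P = ?P * Z * mp_inverse Z"
    using Z X P by (subst assoc_mult_mat[of _ n n _ p _ n]) (auto simp: range_proj_def)
  then have PP: "?P * ?P = ?P" by (simp add: PZ) (simp add: range_proj_def)
  show C: "1\<^sub>m n - ?P \<in> carrier_mat n n" using P by (simp add: minus_carrier_mat)
  show "transpose_mat (1\<^sub>m n - ?P) = 1\<^sub>m n - ?P"
    using transpose_minus[of "1\<^sub>m n" n n ?P] P Pt by simp
  have "?P * (1\<^sub>m n - ?P) = ?P - ?P"
    using mult_minus_distrib_mat[of ?P n n "1\<^sub>m n" n ?P] P PP by simp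
  then have "?P * (1\<^sub>m n - ?P) = 0\<^sub>m n n" using P by simp
  then have "(1\<^sub>m n - ?P) * (1\<^sub>m n - ?P) = (1\<^sub>m n - ?P) - 0\<^sub>m n n"
    using minus_mult_distrib_mat[of "1\<^sub>m n" n n ?P "1\<^sub>m n - ?P" n] P C by simp
  also have "\<dots> = 1\<^sub>m n - ?P" using P by (intro eq_matI) auto
  finally show "(1\<^sub>m n - ?P) * (1\<^sub>m n - ?P) = 1\<^sub>m n - ?P" .
  show "(1\<^sub>m n - ?P) * Z = 0\<^sub>m n p"
    using minus_mult_distrib_mat[of "1\<^sub>m n" n n ?P Z p] P Z PZ by simp
qed

section \<open>The inverse square root\<close>

text \<open>A kernel vector of the square root is a kernel vector of \<open>M\<close>, so the square
  root is invertible.\<close>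

lemma mat_inv_sqrt_props:
  assumes psd: "psd_mat M" and M: "M \<in> carrier_mat n n"
    and ker: "\<And>x. x \<in> carrier_vec n \<Longrightarrow> M *\<^sub>v x = 0\<^sub>v n \<Longrightarrow> x = 0\<^sub>v n"
  shows "mat_inv_sqrt M \<in> carrier_mat n n" and "mat_sqrt M * mat_inv_sqrt M = 1\<^sub>m n"
proof -
  note X = mat_sqrt_props[OF psd M]
  have "x = 0\<^sub>v n" if x: "x \<in> carrier_vec n" and Xx: "mat_sqrt M *\<^sub>v x = 0\<^sub>v n" for x
  proof (rule ker[OF x])
    have "M *\<^sub>v x = mat_sqrt M *\<^sub>v (mat_sqrt M *\<^sub>v x)"
      using assoc_mult_mat_vec[OF X(1) X(1) x] by (simp add: X(3))
    also have "\<dots> = 0\<^sub>v n" unfolding Xx using X(1) by (intro eq_vecI) auto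
    finally show "M *\<^sub>v x = 0\<^sub>v n" .
  qed
  then obtain B where "mat_inverse (mat_sqrt M) = Some B" "B \<in> carrier_mat n n"
      "mat_sqrt M * B = 1\<^sub>m n"
    using mat_inverse_trivial_kernel[OF X(1)] by metis
  then show "mat_inv_sqrt M \<in> carrier_mat n n" "mat_sqrt M * mat_inv_sqrt M = 1\<^sub>m n"
    by (simp_all add: mat_inv_sqrt_def)
qed

text \<open>The quadratic form at \<open>x\<close> is the sum of the squared norms of
  \<open>x\<close> and \<open>transpose_mat T *\<^sub>v x\<close>, which gives both claims. They
  make the inverse square root in \<open>S\<^sub>k\<close> meaningful.\<close>

lemma one_plus_gram:
  assumes T: "T \<in> carrier_mat q k"
  shows "psd_mat (1\<^sub>m q + T * transpose_mat T)"
    and "\<And>x. x \<in> carrier_vec q \<Longrightarrow> (1\<^sub>m q + T * transpose_mat T) *\<^sub>v x = 0\<^sub>v q \<Longrightarrow> x = 0\<^sub>v q"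
proof -
  let ?M = "1\<^sub>m q + T * transpose_mat T"
  have Tt: "transpose_mat T \<in> carrier_mat k q" using T by simp
  have M: "?M \<in> carrier_mat q q" using T by simp
  have form: "x \<bullet> (?M *\<^sub>v x) = x \<bullet> x + (vec_norm2 (transpose_mat T *\<^sub>v x))\<^sup>2"
    if x: "x \<in> carrier_vec q" for x
  proof -
    have "T * transpose_mat T *\<^sub>v x \<in> carrier_vec q"
      by (rule mult_mat_vec_carrier[OF _ x]) (use T in simp)
    then have "x \<bullet> (?M *\<^sub>v x) = x \<bullet> x + x \<bullet> (T * transpose_mat T *\<^sub>v x)"
      using T x add_mult_distrib_mat_vec[of "1\<^sub>m q" q q "T * transpose_mat T" x]
      by (simp add: scalar_prod_add_distrib[of _ q])
    then show ?thesis using vec_norm2_sq_mult_mat_vec[OF Tt x] by simp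
  qed
  have "transpose_mat ?M = ?M"
    using T transpose_add[of "1\<^sub>m q" q q "T * transpose_mat T"]
    by (simp add: transpose_mult[of _ q k _ q])
  then show "psd_mat ?M"
    using M form by (auto simp: psd_mat_def scalar_prod_self_nonneg)
  show "x = 0\<^sub>v q" if x: "x \<in> carrier_vec q" and "?M *\<^sub>v x = 0\<^sub>v q" for x
  proof (rule scalar_prod_self_eq_0[OF x])
    have "x \<bullet> x + (vec_norm2 (transpose_mat T *\<^sub>v x))\<^sup>2 = 0"
      using form[OF x] that by simp
    then show "x \<bullet> x = 0" using scalar_prod_self_nonneg[of x] by (smt (verit) zero_le_power2)
  qed
qed

section \<open>Block columns\<close>

lemma append_cols_carrier:
  assumes "A \<in> carrier_mat r a" and "B \<in> carrier_mat r b"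
  shows "append_cols A B \<in> carrier_mat r (a + b)"
  unfolding append_cols_def
  using four_block_carrier_mat[OF assms(1) zero_carrier_mat[of 0 b]] assms(2) by simp

text \<open>Serves both the completeness relation for the columns of \<open>U\<close> and the
  splitting of \<open>A\<close> into \<open>A\<^sub>k + A\<^sub>r\<close>.\<close>

lemma append_cols_mult_transpose:
  assumes "A \<in> carrier_mat r a" and "B \<in> carrier_mat r b"
    and "C \<in> carrier_mat s a" and "D \<in> carrier_mat s b"
  shows "append_cols A B * transpose_mat (append_cols C D)
    = A * transpose_mat C + B * transpose_mat D"
proof -
  have "transpose_mat (append_cols C D)
      = four_block_mat (transpose_mat C) (0\<^sub>m a 0) (transpose_mat D) (0\<^sub>m b 0)"
    unfolding append_cols_def using assms
    by (subst transpose_four_block_mat[of _ s a _ b _ 0]) auto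
  then show ?thesis
    unfolding append_cols_def using assms
    by (simp add: mult_four_block_mat[of _ r a _ b _ 0 _ _ s _ 0]) (intro eq_matI; auto)
qed

lemma append_cols_mult_diag_block:
  assumes "A \<in> carrier_mat r a" and "B \<in> carrier_mat r b"
    and "C \<in> carrier_mat a c" and "D \<in> carrier_mat b d"
  shows "append_cols A B * diag_block_mat [C, D] = append_cols (A * C) (B * D)"
proof -
  have "diag_block_mat [C, D] = four_block_mat C (0\<^sub>m a d) (0\<^sub>m b c) D"
    unfolding diag_block_mat.simps(2)[of C] diag_block_mat_singleton Let_def using assms by simp
  then show ?thesis
    unfolding append_cols_def using assms
    by (simp add: mult_four_block_mat[of _ r a _ b _ 0 _ _ c _ d])
qed

lemma transpose_append_cols_mult:
  assumes A: "A \<in> carrier_mat r a" and B: "B \<in> carrier_mat r b"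
    and orth: "transpose_mat (append_cols A B) * append_cols A B = 1\<^sub>m (a + b)"
  shows "transpose_mat A * A = 1\<^sub>m a" and "transpose_mat B * B = 1\<^sub>m b"
    and "transpose_mat A * B = 0\<^sub>m a b"
proof -
  let ?U = "append_cols A B"
  have U: "?U \<in> carrier_mat r (a + b)" by (rule append_cols_carrier[OF A B])
  have colA: "col ?U i = col A i" if "i < a" for i
    using A B that by (intro eq_vecI) (auto simp: append_cols_def)
  have colB: "col ?U (a + i) = col B i" if "i < b" for i
    using A B that by (intro eq_vecI) (auto simp: append_cols_def)
  have entry: "col ?U i \<bullet> col ?U j = (if i = j then 1 else 0)" if "i < a + b" "j < a + b" for i j
    using arg_cong[OF orth, of "\<lambda>X. X $$ (i, j)"] that U by simp
  show "transpose_mat A * A = 1\<^sub>m a"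
    using A entry by (intro eq_matI) (auto simp flip: colA)
  show "transpose_mat B * B = 1\<^sub>m b"
    using B entry by (intro eq_matI) (auto simp flip: colB)
  show "transpose_mat A * B = 0\<^sub>m a b"
    using A B entry by (intro eq_matI) (auto simp flip: colA colB)
qed

section \<open>Residuals of the projection\<close>

text \<open>Side conditions on dimensions instead of carriers contain no extra variables, so this
  works as a rewrite rule for rectangular products.\<close>

lemma assoc_mult_mat_dim:
  "dim_col A = dim_row B \<Longrightarrow> dim_col B = dim_row C \<Longrightarrow> A * B * C = A * (B * C)"
  for A B C :: "real mat"
  by (rule assoc_mult_mat) auto

lemma transpose_mult_dim:
  "dim_col A = dim_row B \<Longrightarrow> transpose_mat (A * B) = transpose_mat B * transpose_mat A"
  for A B :: "real mat"
  by (rule transpose_mult) auto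

text \<open>Used with \<open>F\<close> being \<open>K\<close> or \<open>L\<close> and with
  \<open>G\<close> being \<open>transpose_mat V\<^sub>k\<close>.\<close>

lemma norm_sandwich_le:
  assumes N: "N \<in> {spectral_norm, frobenius_norm}"
    and "dim_col F = dim_row B" "dim_col B = dim_row G"
    and "spectral_norm F \<le> 1" "spectral_norm G \<le> 1"
  shows "N (F * B * G) \<le> N B"
proof -
  have "N (F * B * G) \<le> N (F * B) * spectral_norm G"
    by (rule norm_mult_right_le[OF N]) (use assms in auto)
  also have "\<dots> \<le> N (F * B)"
    using assms(5) norm_nonneg[OF N, of "F * B"] by (simp add: mult_left_le)
  also have "\<dots> \<le> spectral_norm F * N B"
    by (rule norm_mult_left_le[OF N]) (use assms in auto)
  also have "\<dots> \<le> N B"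
    using assms(4) norm_nonneg[OF N, of B] by (simp add: mult_left_le_one_le)
  finally show ?thesis .
qed

theorem theorem3p4:
  fixes n m p k :: nat
    and A Z U \<Sigma> V U\<^sub>k U\<^sub>r V\<^sub>k V\<^sub>r \<Sigma>\<^sub>k \<Sigma>\<^sub>r A\<^sub>k A\<^sub>r \<Omega>\<^sub>k \<Omega>\<^sub>r T\<^sub>k S\<^sub>k :: "real mat"
  assumes "A \<in> carrier_mat n m" and "m \<le> n"
    and "is_svd n m A U \<Sigma> V"
    and "Z \<in> carrier_mat n p" and "mat_rank Z = p" and "p \<le> mat_rank A"
    and "1 \<le> k" and "k \<le> p"
    and "U\<^sub>k \<in> carrier_mat n k" and "U\<^sub>r \<in> carrier_mat n (n - k)"
    and "U = append_cols U\<^sub>k U\<^sub>r"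
    and "V\<^sub>k \<in> carrier_mat m k" and "V\<^sub>r \<in> carrier_mat m (m - k)"
    and "V = append_cols V\<^sub>k V\<^sub>r"
    and "\<Sigma>\<^sub>k \<in> carrier_mat k k" and "\<Sigma>\<^sub>r \<in> carrier_mat (n - k) (m - k)"
    and "\<Sigma> = diag_block_mat [\<Sigma>\<^sub>k, \<Sigma>\<^sub>r]"
    and "A\<^sub>k = U\<^sub>k * \<Sigma>\<^sub>k * transpose_mat V\<^sub>k"
    and "A\<^sub>r = U\<^sub>r * \<Sigma>\<^sub>r * transpose_mat V\<^sub>r"
    and "\<Omega>\<^sub>k = transpose_mat U\<^sub>k * Z"
    and "\<Omega>\<^sub>r = transpose_mat U\<^sub>r * Z"
    and "mat_rank \<Omega>\<^sub>k = k"
    and "T\<^sub>k = \<Omega>\<^sub>r * mp_inverse \<Omega>\<^sub>k"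
    and "S\<^sub>k = mat_inv_sqrt (1\<^sub>m (n - k) + T\<^sub>k * transpose_mat T\<^sub>k) * T\<^sub>k"
  shows "\<forall>N \<in> {spectral_norm, frobenius_norm}.
      (N ((1\<^sub>m n - range_proj Z) * A))\<^sup>2 - (N ((1\<^sub>m n - range_proj Z) * A\<^sub>r))\<^sup>2
        \<le> (N ((1\<^sub>m n - range_proj Z) * A\<^sub>k))\<^sup>2 \<and>
      (N ((1\<^sub>m n - range_proj Z) * A\<^sub>k))\<^sup>2
        \<le> min ((N S\<^sub>k)\<^sup>2 * (spectral_norm \<Sigma>\<^sub>k)\<^sup>2) ((N (T\<^sub>k * \<Sigma>\<^sub>k))\<^sup>2)"
proof
  fix N assume N: "N \<in> {spectral_norm, frobenius_norm}"

  \<comment> \<open>Block form of the singular value decomposition\<close>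
  note Z = \<open>Z \<in> carrier_mat n p\<close>
  note Uk = \<open>U\<^sub>k \<in> carrier_mat n k\<close> and Ur = \<open>U\<^sub>r \<in> carrier_mat n (n - k)\<close>
  note Vk = \<open>V\<^sub>k \<in> carrier_mat m k\<close> and Vr = \<open>V\<^sub>r \<in> carrier_mat m (m - k)\<close>
  note Sk = \<open>\<Sigma>\<^sub>k \<in> carrier_mat k k\<close> and Sr = \<open>\<Sigma>\<^sub>r \<in> carrier_mat (n - k) (m - k)\<close>
  note Udef = \<open>U = append_cols U\<^sub>k U\<^sub>r\<close> and Vdef = \<open>V = append_cols V\<^sub>k V\<^sub>r\<close>
  have svd: "U \<in> carrier_mat n n" "U * transpose_mat U = 1\<^sub>m n"
      "V \<in> carrier_mat m m" "transpose_mat V * V = 1\<^sub>m m" "A = U * \<Sigma> * transpose_mat V"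
    using \<open>is_svd n m A U \<Sigma> V\<close> by (auto simp: is_svd_def orthonormal_mat_def)
  have "transpose_mat U * U = 1\<^sub>m n"
    using \<open>is_svd n m A U \<Sigma> V\<close> by (simp add: is_svd_def orthonormal_mat_def)
  \<comment> \<open>Subtraction on \<open>nat\<close> is truncated; \<open>k \<le> n\<close> is read
    off from the number of columns of \<open>U\<close>.\<close>
  moreover have nk: "k + (n - k) = n"
    using append_cols_carrier[OF Uk Ur] svd(1) Udef by (metis carrier_matD(2))
  ultimately have UrUr: "transpose_mat U\<^sub>r * U\<^sub>r = 1\<^sub>m (n - k)"
    using transpose_append_cols_mult[OF Uk Ur] Udef by simp
  have UU: "U\<^sub>k * transpose_mat U\<^sub>k + U\<^sub>r * transpose_mat U\<^sub>r = 1\<^sub>m n"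
    using append_cols_mult_transpose[OF Uk Ur Uk Ur] svd(2) Udef by simp
  have mk: "k + (m - k) = m"
    using append_cols_carrier[OF Vk Vr] svd(3) Vdef by (metis carrier_matD(2))
  then have VkVk: "transpose_mat V\<^sub>k * V\<^sub>k = 1\<^sub>m k" and VkVr: "transpose_mat V\<^sub>k * V\<^sub>r = 0\<^sub>m k (m - k)"
    using transpose_append_cols_mult[OF Vk Vr] svd(4) Vdef by simp_all
  have Ak: "A\<^sub>k \<in> carrier_mat n m" and Ar: "A\<^sub>r \<in> carrier_mat n m"
    using Uk Ur Sk Sr Vk Vr \<open>A\<^sub>k = _\<close> \<open>A\<^sub>r = _\<close> by auto
  have "U * \<Sigma> = append_cols (U\<^sub>k * \<Sigma>\<^sub>k) (U\<^sub>r * \<Sigma>\<^sub>r)"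
    unfolding Udef \<open>\<Sigma> = _\<close> by (rule append_cols_mult_diag_block[OF Uk Ur Sk Sr])
  then have A_split: "A = A\<^sub>k + A\<^sub>r"
    unfolding svd(5) Vdef \<open>A\<^sub>k = _\<close> \<open>A\<^sub>r = _\<close> using Uk Ur Sk Sr Vk Vr
    by (simp add: append_cols_mult_transpose[of _ n k _ "m - k"])

  \<comment> \<open>The residual projection\<close>
  define C where "C = 1\<^sub>m n - range_proj Z"
  have "is_mp_inverse Z (mp_inverse Z)"
    by (rule is_mp_inverse_full_col_rank[OF Z \<open>mat_rank Z = p\<close>])
  note C = range_proj_complement[OF Z this, folded C_def]
  have C_norm: "spectral_norm C \<le> 1"
    by (rule spectral_norm_symmetric_idempotent[OF C(2,3)])
  have Vk_norm: "spectral_norm (transpose_mat V\<^sub>k) \<le> 1"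
    unfolding spectral_norm_transpose by (rule spectral_norm_orthonormal_cols[OF VkVk])

  \<comment> \<open>Lower bound by orthogonality of the two parts of \<open>A\<close>\<close>
  have "A\<^sub>k * transpose_mat A\<^sub>r = U\<^sub>k * \<Sigma>\<^sub>k * (transpose_mat V\<^sub>k * V\<^sub>r) * (transpose_mat \<Sigma>\<^sub>r * transpose_mat U\<^sub>r)"
  proof -
    have "transpose_mat A\<^sub>r = V\<^sub>r * (transpose_mat \<Sigma>\<^sub>r * transpose_mat U\<^sub>r)"
      unfolding \<open>A\<^sub>r = _\<close> using Ur Sr Vr
      by (simp add: transpose_mult_dim)
    then show ?thesis
      unfolding \<open>A\<^sub>k = _\<close> using Uk Sk Vk Ur Sr Vr
      by (simp add: assoc_mult_mat_dim)
  qed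
  then have AkAr: "A\<^sub>k * transpose_mat A\<^sub>r = 0\<^sub>m n n"
    unfolding VkVr using Uk Sk Ur Sr by simp
  have "(C * A\<^sub>k) * transpose_mat (C * A\<^sub>r) = C * (A\<^sub>k * transpose_mat A\<^sub>r) * transpose_mat C"
    using C(1) Ak Ar by (simp add: transpose_mult_dim assoc_mult_mat_dim)
  then have "(C * A\<^sub>k) * transpose_mat (C * A\<^sub>r) = 0\<^sub>m n n"
    unfolding AkAr using C(1) by simp
  then have "(N (C * A\<^sub>k + C * A\<^sub>r))\<^sup>2 \<le> (N (C * A\<^sub>k))\<^sup>2 + (N (C * A\<^sub>r))\<^sup>2"
    using C(1) Ak Ar by (intro norm_sq_add_orthogonal_le[OF N, of _ n m]) auto
  moreover have "C * A = C * A\<^sub>k + C * A\<^sub>r"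
    unfolding A_split by (rule mult_add_distrib_mat[OF C(1) Ak Ar])
  ultimately have first: "(N (C * A))\<^sup>2 - (N (C * A\<^sub>r))\<^sup>2 \<le> (N (C * A\<^sub>k))\<^sup>2" by simp

  \<comment> \<open>The range of \<open>Z\<close> and the matrix \<open>T\<^sub>k\<close>\<close>
  have Ok: "\<Omega>\<^sub>k \<in> carrier_mat k p" and Or: "\<Omega>\<^sub>r \<in> carrier_mat (n - k) p"
    using Uk Ur Z \<open>\<Omega>\<^sub>k = _\<close> \<open>\<Omega>\<^sub>r = _\<close> by auto
  define G where "G = mp_inverse \<Omega>\<^sub>k"
  have G: "G \<in> carrier_mat p k" "\<Omega>\<^sub>k * G = 1\<^sub>m k"
    using mp_inverse_full_row_rank[OF Ok \<open>mat_rank \<Omega>\<^sub>k = k\<close>] by (simp_all add: G_def)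
  have Tdef: "T\<^sub>k = \<Omega>\<^sub>r * G" using \<open>T\<^sub>k = _\<close> by (simp add: G_def)
  have T: "T\<^sub>k \<in> carrier_mat (n - k) k" using Or G Tdef by simp
  \<comment> \<open>Expanding \<open>Z * G\<close> in the orthonormal basis \<open>U\<close>, the
    coordinates along \<open>U\<^sub>k\<close> are \<open>\<Omega>\<^sub>k * G = 1\<close> and those
    along \<open>U\<^sub>r\<close> are \<open>T\<^sub>k\<close>. So the range of \<open>Z\<close>
    contains the graph of \<open>T\<^sub>k\<close>.\<close>
  have ZG: "Z * G = U\<^sub>k + U\<^sub>r * T\<^sub>k"
  proof -
    have ZGc: "Z * G \<in> carrier_mat n k" using Z G by simp
    have "Z * G = U\<^sub>k * transpose_mat U\<^sub>k * (Z * G) + U\<^sub>r * transpose_mat U\<^sub>r * (Z * G)"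
      using add_mult_distrib_mat[of "U\<^sub>k * transpose_mat U\<^sub>k" n n "U\<^sub>r * transpose_mat U\<^sub>r" "Z * G" k]
        ZGc Uk Ur by (simp add: UU left_mult_one_mat[OF ZGc])
    also have "U\<^sub>k * transpose_mat U\<^sub>k * (Z * G) = U\<^sub>k * (\<Omega>\<^sub>k * G)"
      unfolding \<open>\<Omega>\<^sub>k = _\<close> using Uk Z G(1)
      by (simp add: assoc_mult_mat_dim)
    also have "\<dots> = U\<^sub>k" unfolding G(2) using Uk by simp
    also have "U\<^sub>r * transpose_mat U\<^sub>r * (Z * G) = U\<^sub>r * T\<^sub>k"
      unfolding Tdef \<open>\<Omega>\<^sub>r = _\<close> using Ur Z G(1)
      by (simp add: assoc_mult_mat_dim)
    finally show ?thesis .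
  qed

  \<comment> \<open>Factorization of the residual of \<open>U\<^sub>k\<close> through
    \<open>T\<^sub>k\<close>\<close>
  define K where "K = C * (- U\<^sub>r)"
  have K: "K \<in> carrier_mat n (n - k)" using C(1) Ur by (simp add: K_def)
  have K_norm: "spectral_norm K \<le> 1"
  proof -
    have "spectral_norm K \<le> spectral_norm C * spectral_norm (- U\<^sub>r)"
      unfolding K_def using C(1) Ur by (intro norm_mult_left_le) auto
    also have "\<dots> \<le> 1 * 1"
      using C_norm spectral_norm_orthonormal_cols[OF UrUr] by (intro mult_mono) auto
    finally show ?thesis by simp
  qed
  \<comment> \<open>\<open>C\<close> annihilates \<open>Z * G\<close>, hence the sum in
    \<open>ZG\<close>; the sign in \<open>K\<close> absorbs the resulting minus.\<close>
  have CUk: "C * U\<^sub>k = K * T\<^sub>k"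
  proof -
    have "C * U\<^sub>k + C * (U\<^sub>r * T\<^sub>k) = C * Z * G"
      using mult_add_distrib_mat[of C n n U\<^sub>k k "U\<^sub>r * T\<^sub>k"] assoc_mult_mat[of C n n Z p G k]
        C(1) Uk Ur T Z G(1) by (simp add: ZG)
    then have sum0: "C * U\<^sub>k + C * (U\<^sub>r * T\<^sub>k) = 0\<^sub>m n k" using C(4) G(1) by simp
    have "K * T\<^sub>k = - (C * (U\<^sub>r * T\<^sub>k))"
      unfolding K_def using C(1) Ur T by (simp add: assoc_mult_mat_dim)
    moreover have "C * U\<^sub>k = - (C * (U\<^sub>r * T\<^sub>k))"
    proof (rule eq_matI)
      fix i j assume "i < dim_row (- (C * (U\<^sub>r * T\<^sub>k)))" "j < dim_col (- (C * (U\<^sub>r * T\<^sub>k)))"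
      then show "(C * U\<^sub>k) $$ (i, j) = (- (C * (U\<^sub>r * T\<^sub>k))) $$ (i, j)"
        using arg_cong[OF sum0, of "\<lambda>X. X $$ (i, j)"] C(1) Uk Ur T by simp
    qed (use C(1) Uk Ur T in auto)
    ultimately show ?thesis by simp
  qed

  \<comment> \<open>The contraction \<open>L\<close> for the factorization through
    \<open>S\<^sub>k\<close>\<close>
  define M where "M = 1\<^sub>m (n - k) + T\<^sub>k * transpose_mat T\<^sub>k"
  have M: "M \<in> carrier_mat (n - k) (n - k)" using T by (simp add: M_def)
  define X where "X = mat_sqrt M"
  define R where "R = mat_inv_sqrt M"
  note gram = one_plus_gram[OF T, folded M_def]
  note X = mat_sqrt_props[OF gram(1) M, folded X_def]
  note R = mat_inv_sqrt_props[OF gram(1) M gram(2), folded X_def R_def]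
  have Sdef: "S\<^sub>k = R * T\<^sub>k" using \<open>S\<^sub>k = _\<close> by (simp add: R_def M_def)
  define L where "L = K * X"
  have L: "L \<in> carrier_mat n (n - k)" using K X by (simp add: L_def)
  have LL: "L * transpose_mat L = C"
  proof -
    have "transpose_mat X = X" using X(2) by (simp add: psd_mat_def)
    then have "L * transpose_mat L = K * (X * X) * transpose_mat K"
      using K X(1) unfolding L_def
      by (simp add: transpose_mult_dim assoc_mult_mat_dim)
    also have "\<dots> = K * transpose_mat K + (K * T\<^sub>k) * transpose_mat (K * T\<^sub>k)"
      unfolding X(3) M_def using K T
      by (simp add: mult_add_distrib_mat[of _ n "n - k" _ "n - k"] add_mult_distrib_mat[of _ n "n - k" _ _ n]
          transpose_mult_dim assoc_mult_mat_dim)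
    also have "K * transpose_mat K = C * (U\<^sub>r * transpose_mat U\<^sub>r) * C"
    proof -
      \<comment> \<open>A name for \<open>- U\<^sub>r\<close> keeps it a single factor during
        reassociation; the two signs cancel in \<open>Y * transpose_mat Y\<close>.\<close>
      define Y where "Y = - U\<^sub>r"
      have Y: "Y \<in> carrier_mat n (n - k)" using Ur by (simp add: Y_def)
      have "Y * transpose_mat Y = U\<^sub>r * transpose_mat U\<^sub>r"
        using Ur by (intro eq_matI) (auto simp: Y_def scalar_prod_def sum_negf)
      moreover have "K * transpose_mat K = C * (Y * transpose_mat Y) * C"
        unfolding K_def Y_def[symmetric] using C(1,2) Y
        by (simp add: transpose_mult_dim assoc_mult_mat_dim)
      ultimately show ?thesis by simp
    qed
    also have "(K * T\<^sub>k) * transpose_mat (K * T\<^sub>k) = C * (U\<^sub>k * transpose_mat U\<^sub>k) * C"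
      unfolding CUk[symmetric] using C(1,2) Uk
      by (simp add: transpose_mult_dim assoc_mult_mat_dim)
    also have "C * (U\<^sub>r * transpose_mat U\<^sub>r) * C + C * (U\<^sub>k * transpose_mat U\<^sub>k) * C
        = C * (U\<^sub>r * transpose_mat U\<^sub>r + U\<^sub>k * transpose_mat U\<^sub>k) * C"
      using C(1) Uk Ur
      by (simp add: mult_add_distrib_mat[of _ n n _ n] add_mult_distrib_mat[of _ n n _ _ n])
    also have "U\<^sub>r * transpose_mat U\<^sub>r + U\<^sub>k * transpose_mat U\<^sub>k = 1\<^sub>m n"
      using comm_add_mat[of "U\<^sub>k * transpose_mat U\<^sub>k" n n "U\<^sub>r * transpose_mat U\<^sub>r"] Uk Ur UU by simp
    also have "C * 1\<^sub>m n * C = C" using C(1,3) by simp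
    finally show ?thesis .
  qed
  \<comment> \<open>\<open>LL\<close> gives the Gram matrix of \<open>transpose_mat L\<close>, so
    the bound is obtained for the transpose and carried over to \<open>L\<close>.\<close>
  have L_norm: "spectral_norm L \<le> 1"
  proof -
    have "(spectral_norm L)\<^sup>2 \<le> 1"
      using spectral_norm_sq_le[of "transpose_mat L"] C_norm by (simp add: LL spectral_norm_transpose)
    then show ?thesis using power2_le_imp_le[of "spectral_norm L" 1] by simp
  qed

  \<comment> \<open>The two upper bounds\<close>
  have S: "S\<^sub>k \<in> carrier_mat (n - k) k" using R T Sdef by simp
  have CAk: "C * A\<^sub>k = C * U\<^sub>k * \<Sigma>\<^sub>k * transpose_mat V\<^sub>k"
    unfolding \<open>A\<^sub>k = _\<close> using C(1) Uk Sk Vk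
    by (simp add: assoc_mult_mat_dim)
  have "C * A\<^sub>k = K * (T\<^sub>k * \<Sigma>\<^sub>k) * transpose_mat V\<^sub>k"
    unfolding CAk CUk using K T Sk by (simp add: assoc_mult_mat_dim)
  then have T_bound: "N (C * A\<^sub>k) \<le> N (T\<^sub>k * \<Sigma>\<^sub>k)"
    using norm_sandwich_le[OF N _ _ K_norm Vk_norm, of "T\<^sub>k * \<Sigma>\<^sub>k"] K T Sk Vk by simp
  \<comment> \<open>The square root inside \<open>L\<close> meets its inverse inside
    \<open>S\<^sub>k\<close>, and what remains is \<open>K * T\<^sub>k\<close>.\<close>
  have "L * S\<^sub>k = K * (X * R) * T\<^sub>k"
    unfolding L_def Sdef using K X(1) R(1) T
    by (simp add: assoc_mult_mat_dim)
  then have LS: "C * U\<^sub>k = L * S\<^sub>k" using K by (simp add: CUk R(2))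
  have "C * A\<^sub>k = L * (S\<^sub>k * \<Sigma>\<^sub>k) * transpose_mat V\<^sub>k"
    unfolding CAk LS using L S Sk by (simp add: assoc_mult_mat_dim)
  then have "N (C * A\<^sub>k) \<le> N (S\<^sub>k * \<Sigma>\<^sub>k)"
    using norm_sandwich_le[OF N _ _ L_norm Vk_norm, of "S\<^sub>k * \<Sigma>\<^sub>k"] L S Sk Vk by simp
  \<comment> \<open>Only \<open>S\<^sub>k\<close> keeps the norm \<open>N\<close>;
    \<open>\<Sigma>\<^sub>k\<close> is split off in the spectral norm, also when \<open>N\<close> is
    the Frobenius norm.\<close>
  also have "\<dots> \<le> N S\<^sub>k * spectral_norm \<Sigma>\<^sub>k"
    using S Sk by (intro norm_mult_right_le[OF N]) auto
  finally have S_bound: "N (C * A\<^sub>k) \<le> N S\<^sub>k * spectral_norm \<Sigma>\<^sub>k" .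
  have "(N (C * A\<^sub>k))\<^sup>2 \<le> (N S\<^sub>k)\<^sup>2 * (spectral_norm \<Sigma>\<^sub>k)\<^sup>2"
    using power_mono[OF S_bound norm_nonneg[OF N], of 2] by (simp add: power_mult_distrib)
  moreover have "(N (C * A\<^sub>k))\<^sup>2 \<le> (N (T\<^sub>k * \<Sigma>\<^sub>k))\<^sup>2"
    by (rule power_mono[OF T_bound norm_nonneg[OF N]])
  ultimately show "(N ((1\<^sub>m n - range_proj Z) * A))\<^sup>2 - (N ((1\<^sub>m n - range_proj Z) * A\<^sub>r))\<^sup>2
        \<le> (N ((1\<^sub>m n - range_proj Z) * A\<^sub>k))\<^sup>2 \<and>
      (N ((1\<^sub>m n - range_proj Z) * A\<^sub>k))\<^sup>2
        \<le> min ((N S\<^sub>k)\<^sup>2 * (spectral_norm \<Sigma>\<^sub>k)\<^sup>2) ((N (T\<^sub>k * \<Sigma>\<^sub>k))\<^sup>2)"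
    using first by (simp add: C_def)
qed

end
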